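(* Let $f_\pi,f_\rho\in C^0(U;\mathbb{R}_+)$ be two positive probability densities with respect to $\mu$, let $\pi,\rho$ be the corresponding measures on $U$, and let $T=(T_k)_{k\in\mathbb{N}}$ be the Knothe–Rosenblatt transport constructed in the context. Then: (i) $T:U\to U$ is measurable, bijective and satisfies $T_\sharp\rho=\pi$; (ii) for each $k\in\mathbb{N}$ it holds $\partial_kT_k\in C^0(U_k;\mathbb{R}_+)$, and $$\det dT(y):=\lim_{n\to\infty}\prod_{j=1}^n\partial_jT_j(y_{[j]})\in C^0(U;\mathbb{R}_+)$$ is well-defined (i.e. the limit converges in $C^0(U;\mathbb{R}_+)$, uniformly on $U$). Moreover $$f_\pi(T(y))\,\det dT(y)=f_\rho(y)\qquad\forall y\in U.$$
   Context: Notation. $\mathbb{N}=\{1,2,\dots\}$, $\mathbb{R}_+=(0,\infty)$, $U_k=[-1,1]^k$, $U=[-1,1]^{\mathbb{N}}$ with the product topology and Borel $\sigma$-algebra. $\lambda$ is Lebesgue measure on $[-1,1]$ and $\mu=\bigotimes_{j\in\mathbb{N}}\frac\lambda2$ on $U$; also $\mu=\bigotimes_{j=1}^k\frac\lambda2$ on $U_k$. $y_{[k]}=(y_1,\dots,y_k)$; $\partial_j$ is the derivative in the $j$th variable. $C^0(A;B)$ denotes continuous functions $A\to B$. A positive probability density is $f:U\to\mathbb{R}$ with $f>0$ on $U$ and $\int_Uf\,d\mu=1$. Knothe–Rosenblatt transport. For $*\in\{\rho,\pi\}$ set $\hat f_{*,0}=1$ and for $k\in\mathbb{N}$ $$\hat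 f_{*,k}(y_{[k]})=\int_Uf_*(y_{[k]},t)\,d\mu(t),\qquad f_{*,k}(y_{[k]})=\frac{\hat f_{*,k}(y_{[k]})}{\hat f_{*,k-1}(y_{[k-1]})}.$$ Let $\rho_1,\pi_1$ be the measures on $U_1$ with $\mu$-densities $\hat f_{\rho,1},\hat f_{\pi,1}$, and for $y_{[k]}\in U_k$ let $\rho_{k+1}^{y_{[k]}}$, $\pi_{k+1}^{y_{[k]}}$ be the measures on $U_1$ with $\mu$-densities $f_{\rho,k+1}(y_{[k]},\cdot)$, $f_{\pi,k+1}(y_{[k]},\cdot)$. $T_1:U_1\to U_1$ is the unique monotonically increasing map with $(T_1)_\sharp\rho_1=\pi_1$, and inductively, with $T_{[k]}=(T_j)_{j=1}^k:U_k\to U_k$, for every $y_{[k]}\in U_k$ the map $T_{k+1}(y_{[k]},\cdot):U_1\to U_1$ is the unique monotonically increasing map with $(T_{k+1}(y_{[k]},\cdot))_\sharp\rho_{k+1}^{y_{[k]}}=\pi_{k+1}^{T_{[k]}(y_{[k]})}$. Then $T=(T_k)_{k\in\mathbb{N}}$. *)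

theory Defs
  imports "HOL-Probability.Probability"
begin

text \<open>
  Coordinates are numbered from 0: the \<open>j\<close>-th coordinate of the mathematical text is \<open>y (j - 1)\<close>, and
  likewise \<open>KR_comp f\<rho> f\<pi> k\<close> below is the component \<open>T\<close> with index \<open>k + 1\<close>, a function on \<open>cube (Suc k)\<close>.
  A point of \<open>[-1,1]\<^sup>k\<close> is an extensional function on \<open>{..<k}\<close>.  Inside the product topology of
  \<^typ>\<open>nat \<Rightarrow> real\<close>, the subspaces \<open>cube k\<close> and \<open>cubeN\<close> carry exactly the topologies of
  \<open>[-1,1]\<^sup>k\<close> and of the infinite product.
\<close>

definition cube :: "nat \<Rightarrow> (nat \<Rightarrow> real) set" where
  "cube k = {..<k} \<rightarrow>\<^sub>E {-1..1}"

definition cubeN :: "(nat \<Rightarrow> real) set" where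
  "cubeN = UNIV \<rightarrow>\<^sub>E {-1..1}"

abbreviation trunc :: "nat \<Rightarrow> (nat \<Rightarrow> real) \<Rightarrow> (nat \<Rightarrow> real)" where
  "trunc k y \<equiv> restrict y {..<k}"

definition mu1 :: "real measure" where
  "mu1 = scale_measure (1/2) (restrict_space lborel {-1..1})"

definition mu :: "(nat \<Rightarrow> real) measure" where
  "mu = (\<Pi>\<^sub>M j\<in>UNIV. mu1)"

lemma space_mu1: "space mu1 = {-1..1}"
  by (simp add: mu1_def space_scale_measure space_restrict_space)

lemma space_mu: "space mu = cubeN"
  by (simp add: mu_def cubeN_def space_PiM space_mu1)

text \<open>The \<open>\<sigma>\<close>-algebra of \<^const>\<open>mu\<close> is the Borel \<open>\<sigma>\<close>-algebra of the product topology.\<close>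

lemma sets_mu: "sets mu = sets (restrict_space borel cubeN)"
proof
  have m1: "sets mu1 = sets (restrict_space borel {-1..1})"
    by (simp add: mu1_def sets_restrict_space)
  have "(\<lambda>y. y j) \<in> restrict_space borel cubeN \<rightarrow>\<^sub>M mu1" for j
    by (subst measurable_cong_sets[OF refl m1], rule measurable_restrict_space3)
      (auto simp: cubeN_def intro: borel_measurable_continuous_onI continuous_on_product_coordinates)
  then have "(\<lambda>y. y) \<in> restrict_space borel cubeN \<rightarrow>\<^sub>M mu"
    unfolding mu_def
    by (intro measurable_PiM_single') (auto simp: space_restrict_space space_mu1 cubeN_def)
  from measurable_sets[OF this] show "sets mu \<subseteq> sets (restrict_space borel cubeN)"
    using sets.sets_into_space[of _ mu] by (fastforce simp: space_mu space_restrict_space Int_absorb2)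
next
  have "(\<lambda>y. y j) \<in> borel_measurable mu" for j
  proof -
    have "(\<lambda>y. y j) \<in> mu \<rightarrow>\<^sub>M mu1" unfolding mu_def by simp
    moreover have "(\<lambda>x. x) \<in> borel_measurable mu1"
      by (intro measurableI) (simp_all add: mu1_def space_scale_measure space_restrict_space
        sets_restrict_space Int_commute vimage_def)
    ultimately show ?thesis by (rule measurable_compose)
  qed
  then have "(\<lambda>y. y) \<in> mu \<rightarrow>\<^sub>M PiM UNIV (\<lambda>_. borel)"
    by (intro measurable_PiM_single') auto
  then have "(\<lambda>y. y) \<in> mu \<rightarrow>\<^sub>M borel"
    by (simp add: measurable_cong_sets[OF refl sets_PiM_equal_borel])
  from measurable_sets[OF this] show "sets (restrict_space borel cubeN) \<subseteq> sets mu"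
    by (auto simp: sets_restrict_space space_mu Int_commute)
qed

definition C0_pos :: "'a::topological_space set \<Rightarrow> ('a \<Rightarrow> real) set" where
  "C0_pos A = {g. continuous_on A g \<and> (\<forall>x\<in>A. g x > 0)}"

definition prob_density_mu :: "((nat \<Rightarrow> real) \<Rightarrow> real) \<Rightarrow> bool" where
  "prob_density_mu f \<longleftrightarrow> (\<forall>y\<in>cubeN. f y > 0) \<and> (\<integral>y. f y \<partial>mu) = 1"

definition density_mu :: "((nat \<Rightarrow> real) \<Rightarrow> real) \<Rightarrow> (nat \<Rightarrow> real) measure" where
  "density_mu f = density mu (\<lambda>y. ennreal (f y))"

text \<open>\<open>marg f k\<close> and \<open>cond_dens f k\<close> are the marginal and the conditional density with index \<open>k\<close>, the
  number of variables; \<^const>\<open>comb_seq\<close> concatenates the first \<open>k\<close> coordinates of \<open>y\<close> with \<open>t\<close>.\<close>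

definition marg :: "((nat \<Rightarrow> real) \<Rightarrow> real) \<Rightarrow> nat \<Rightarrow> (nat \<Rightarrow> real) \<Rightarrow> real" where
  "marg f k y = (if k = 0 then 1 else \<integral>t. f (comb_seq k y t) \<partial>mu)"

definition cond_dens :: "((nat \<Rightarrow> real) \<Rightarrow> real) \<Rightarrow> nat \<Rightarrow> (nat \<Rightarrow> real) \<Rightarrow> real" where
  "cond_dens f k y = marg f k y / marg f (k - 1) (trunc (k - 1) y)"

text \<open>For \<open>y \<in> cube k\<close>, the conditional measure on \<open>[-1,1]\<close> of the next coordinate; for \<open>k = 0\<close> this is
  the first marginal, because \<open>marg f 0 = 1\<close>.\<close>

definition cond_measure :: "((nat \<Rightarrow> real) \<Rightarrow> real) \<Rightarrow> nat \<Rightarrow> (nat \<Rightarrow> real) \<Rightarrow> real measure" where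
  "cond_measure f k y = density mu1 (\<lambda>t. ennreal (cond_dens f (Suc k) (y(k := t))))"

text \<open>``Increasing'' is read as nondecreasing.  For measures on \<open>[-1,1]\<close> of equal mass with positive densities
  such a map exists and is unique at every point, including the end points, so the description below
  is proper; restricting \<open>S\<close> to extensional functions only fixes its values outside \<open>[-1,1]\<close>.\<close>

definition monotone_transport :: "real measure \<Rightarrow> real measure \<Rightarrow> real \<Rightarrow> real" where
  "monotone_transport M N = (THE S. S \<in> {-1..1} \<rightarrow>\<^sub>E {-1..1} \<and> mono_on {-1..1} S \<and>
     S \<in> M \<rightarrow>\<^sub>M N \<and> distr M N S = N)"

lemma restrict_fundef_cong [fundef_cong]:
  "A = B \<Longrightarrow> (\<And>x. x \<in> B \<Longrightarrow> f x = g x) \<Longrightarrow> restrict f A = restrict g B"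
  by (auto simp: restrict_def)

function KR_comp ::
  "((nat \<Rightarrow> real) \<Rightarrow> real) \<Rightarrow> ((nat \<Rightarrow> real) \<Rightarrow> real) \<Rightarrow> nat \<Rightarrow> (nat \<Rightarrow> real) \<Rightarrow> real" where
  "KR_comp f\<rho> f\<pi> k y =
     monotone_transport
       (cond_measure f\<rho> k (trunc k y))
       (cond_measure f\<pi> k (\<lambda>j\<in>{..<k}. KR_comp f\<rho> f\<pi> j (trunc (Suc j) y)))
       (y k)"
  by pat_completeness auto
termination
  by (relation "Wellfounded.measure (\<lambda>(_, _, k, _). k)") auto

declare KR_comp.simps [simp del]

definition KR_transport ::
  "((nat \<Rightarrow> real) \<Rightarrow> real) \<Rightarrow> ((nat \<Rightarrow> real) \<Rightarrow> real) \<Rightarrow> (nat \<Rightarrow> real) \<Rightarrow> (nat \<Rightarrow> real)" where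
  "KR_transport f\<rho> f\<pi> y = (\<lambda>k. KR_comp f\<rho> f\<pi> k (trunc (Suc k) y))"

text \<open>The derivative in the coordinate with index \<open>j\<close> is taken within \<open>[-1,1]\<close>, hence it is
  one-sided at the two end points.\<close>

definition partial_differentiable :: "nat \<Rightarrow> ((nat \<Rightarrow> real) \<Rightarrow> real) \<Rightarrow> (nat \<Rightarrow> real) \<Rightarrow> bool" where
  "partial_differentiable j g y \<longleftrightarrow>
     (\<lambda>t. g (y(j := t))) differentiable (at (y j) within {-1..1})"

definition partial_deriv :: "nat \<Rightarrow> ((nat \<Rightarrow> real) \<Rightarrow> real) \<Rightarrow> (nat \<Rightarrow> real) \<Rightarrow> real" where
  "partial_deriv j g y = vector_derivative (\<lambda>t. g (y(j := t))) (at (y j) within {-1..1})"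

definition KR_jac_prod ::
  "((nat \<Rightarrow> real) \<Rightarrow> real) \<Rightarrow> ((nat \<Rightarrow> real) \<Rightarrow> real) \<Rightarrow> nat \<Rightarrow> (nat \<Rightarrow> real) \<Rightarrow> real" where
  "KR_jac_prod f\<rho> f\<pi> n y = (\<Prod>j<n. partial_deriv j (KR_comp f\<rho> f\<pi> j) (trunc (Suc j) y))"

definition KR_det :: "((nat \<Rightarrow> real) \<Rightarrow> real) \<Rightarrow> ((nat \<Rightarrow> real) \<Rightarrow> real) \<Rightarrow> (nat \<Rightarrow> real) \<Rightarrow> real" where
  "KR_det f\<rho> f\<pi> y = lim (\<lambda>n. KR_jac_prod f\<rho> f\<pi> n y)"

end

theory Submission
  imports Defs
begin

text \<open>
  For a density \<open>f\<close> let \<open>cond_cdf f k y\<close> be the distribution function, evaluated at \<open>y k\<close>, of the conditional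
  law of the coordinate \<open>k\<close> given the previous ones.  The transport \<open>T\<close> is characterised by
  \<open>cond_cdf f\<pi> k (T y) = cond_cdf f\<rho> k y\<close> for all \<open>k\<close>, and \<open>y\<close> is determined by the values
  \<open>cond_cdf f k y\<close>, so the transport in the opposite direction is the inverse of \<open>T\<close>.  Differentiating the
  characterisation in the coordinate \<open>k\<close> shows that \<open>\<partial>\<^sub>k T\<^sub>k\<close> is the quotient of the conditional densities
  at \<open>y\<close> and at \<open>T y\<close>; hence the product of the first \<open>n\<close> derivatives telescopes to
  \<open>marg f\<rho> n y / marg f\<pi> n (T y)\<close>.  The marginals converge uniformly to the densities, since a density is
  uniformly continuous on the compact \<open>cubeN\<close> and \<open>comb_seq n y t\<close> differs from \<open>y\<close> only in late
  coordinates.  Finally \<open>T\<close> pushes \<open>\<rho>\<close> to \<open>\<pi>\<close>: disintegrating with respect to the last coordinate,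
  one checks this by induction on \<open>n\<close> for functions of the first \<open>n\<close> coordinates.
\<close>

section \<open>Monotone transport of positive densities on the interval\<close>

text \<open>As a density with respect to Lebesgue measure, \<open>mu1\<close> falls under the
  integration and almost-everywhere rules for \<open>density\<close>. The constant 1/2 is the source
  of all factors 2 below.\<close>

lemma mu1_eq_density: "mu1 = density (restrict_space lborel {-1..1}) (\<lambda>_. ennreal (1/2))"
proof -
  have "ennreal (1/2) = 1/2"
    by (metis divide_numeral_1 ennreal_1 ennreal_divide_numeral ennreal_numeral zero_le_one)
  then show ?thesis
    by (intro measure_eqI) (auto simp: mu1_def emeasure_density_const)
qed

lemma sets_mu1: "sets mu1 = sets (restrict_space borel {-1..1})"
  by (simp add: mu1_def sets_restrict_space)

lemma integral_mu1:
  fixes g :: "real \<Rightarrow> real"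
  assumes "g \<in> borel_measurable (restrict_space borel {-1..1})"
  shows "(\<integral>s. g s \<partial>mu1) = (LINT s:{-1..1}|lborel. g s) / 2"
proof -
  have "g \<in> borel_measurable (restrict_space lborel {-1..1})"
    using assms by (simp cong: measurable_cong_sets add: sets_restrict_space)
  then have "(\<integral>s. g s \<partial>mu1) = (\<integral>s. (1/2) *\<^sub>R g s \<partial>restrict_space lborel {-1..1})"
    unfolding mu1_eq_density by (subst integral_density) auto
  then show ?thesis
    by (simp add: integral_restrict_space set_lebesgue_integral_def)
qed

lemma prob_space_mu1: "prob_space mu1"
  by (rule prob_spaceI)
    (simp add: mu1_def space_scale_measure emeasure_restrict_space space_restrict_space
      ennreal_divide_times ennreal_numeral[symmetric] ennreal_mult[symmetric] ennreal_1[symmetric]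
      del: ennreal_numeral ennreal_1)

section \<open>Distribution functions of positive densities on \<open>[-1,1]\<close>\<close>

definition pos_dens :: "(real \<Rightarrow> real) \<Rightarrow> bool" where
  "pos_dens p \<longleftrightarrow> continuous_on {-1..1} p \<and> (\<forall>t\<in>{-1..1}. 0 < p t) \<and> (\<integral>t. p t \<partial>mu1) = 1"

text \<open>The upper limit enters through an indicator, so the measure of integration stays fixed;
  dominated convergence can then be applied when \<open>t\<close> and \<open>p\<close> vary
  together.\<close>

definition dens_cdf :: "(real \<Rightarrow> real) \<Rightarrow> real \<Rightarrow> real" where
  "dens_cdf p t = (\<integral>s. indicator {..t} s * p s \<partial>mu1)"

lemma dens_cdf_eq_integral:
  assumes "continuous_on {-1..1} p" "t \<in> {-1..1}"
  shows "dens_cdf p t = integral {-1..t} p / 2"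
proof -
  have [measurable]: "p \<in> borel_measurable (restrict_space borel {-1..1})"
    by (rule borel_measurable_continuous_on_restrict) fact
  have c: "continuous_on {-1..t} p"
    by (rule continuous_on_subset[OF assms(1)]) (use assms in auto)
  have "(\<lambda>s. indicator {..t} s * p s) \<in> borel_measurable (restrict_space borel {-1..1})"
    by (rule borel_measurable_times[OF measurable_restrict_space1]) (simp, fact)
  from integral_mu1[OF this]
  have "dens_cdf p t = (LINT s:{-1..1}|lborel. indicator {..t} s * p s) / 2"
    by (simp add: dens_cdf_def)
  also have "(LINT s:{-1..1}|lborel. indicator {..t} s * p s) = (LINT s:{-1..t}|lborel. p s)"
    unfolding set_lebesgue_integral_def
    by (rule Bochner_Integration.integral_cong) (use assms(2) in \<open>auto simp: indicator_def\<close>)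
  also have "\<dots> = integral {-1..t} p"
    by (rule set_borel_integral_eq_integral) (rule borel_integrable_atLeastAtMost', fact c)
  finally show ?thesis .
qed

lemma dens_cdf_1:
  assumes "pos_dens p"
  shows "dens_cdf p 1 = 1"
proof -
  have "dens_cdf p 1 = (\<integral>t. p t \<partial>mu1)"
    unfolding dens_cdf_def by (rule Bochner_Integration.integral_cong) (auto simp: space_mu1)
  then show ?thesis using assms by (simp add: pos_dens_def)
qed

lemma dens_cdf_minus_1: "pos_dens p \<Longrightarrow> dens_cdf p (-1) = 0"
  by (simp add: dens_cdf_eq_integral pos_dens_def)

text \<open>This is the fundamental theorem of calculus. The identification with an interval
  integral is available only for \<open>t\<close> in \<open>[-1,1]\<close>, hence the transfer
  within that interval.\<close>

lemma dens_cdf_has_derivative: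
  assumes "pos_dens p" "t \<in> {-1..1}"
  shows "(dens_cdf p has_real_derivative p t / 2) (at t within {-1..1})"
proof (rule has_field_derivative_transform_within[OF _ zero_less_one])
  show "((\<lambda>t. integral {-1..t} p / 2) has_real_derivative p t / 2) (at t within {-1..1})"
    by (intro DERIV_cdivide integral_has_real_derivative) (use assms in \<open>auto simp: pos_dens_def\<close>)
qed (use assms in \<open>auto simp: pos_dens_def dens_cdf_eq_integral\<close>)

lemma continuous_on_dens_cdf: "pos_dens p \<Longrightarrow> continuous_on {-1..1} (dens_cdf p)"
  by (rule DERIV_continuous_on[OF dens_cdf_has_derivative])

lemma dens_cdf_diff_ge:
  assumes p: "pos_dens p" and c: "\<And>t. t \<in> {-1..1} \<Longrightarrow> c \<le> p t"
    and ab: "-1 \<le> a" "a \<le> b" "b \<le> 1"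
  shows "c / 2 * (b - a) \<le> dens_cdf p b - dens_cdf p a"
proof -
  have "\<exists>x\<in>{a..b}. dens_cdf p b - dens_cdf p a = p x / 2 * (b - a)"
  proof (rule mvt_very_simple)
    fix x assume "a \<le> x" "x \<le> b"
    then have "(dens_cdf p has_real_derivative p x / 2) (at x within {-1..1})"
      using ab by (intro dens_cdf_has_derivative p) auto
    then show "(dens_cdf p has_derivative (*) (p x / 2)) (at x within {a..b})"
      unfolding has_field_derivative_def by (rule has_derivative_subset) (use ab in auto)
  qed (use ab in auto)
  then obtain x where "x \<in> {a..b}" "dens_cdf p b - dens_cdf p a = p x / 2 * (b - a)" ..
  then show ?thesis using c[of x] ab by (auto intro!: mult_right_mono)
qed

text \<open>The inverse distribution function is Lipschitz with constant \<open>2 / c\<close>, by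
  the mean value theorem. Both continuity proofs for the transport, in its own variable and in the
  parameters, rest on this.\<close>

lemma dens_cdf_abs_diff_ge:
  assumes p: "pos_dens p" and c: "0 < c" "\<And>t. t \<in> {-1..1} \<Longrightarrow> c \<le> p t"
    and ab: "a \<in> {-1..1}" "b \<in> {-1..1}"
  shows "\<bar>b - a\<bar> \<le> 2 / c * \<bar>dens_cdf p b - dens_cdf p a\<bar>"
proof -
  have *: "c * \<bar>b - a\<bar> \<le> 2 * \<bar>dens_cdf p b - dens_cdf p a\<bar>"
    if "a \<le> b" "a \<in> {-1..1}" "b \<in> {-1..1}" for a b
  proof -
    have "c / 2 * (b - a) \<le> dens_cdf p b - dens_cdf p a"
      using that by (intro dens_cdf_diff_ge p c(2)) auto
    also have "\<dots> \<le> \<bar>dens_cdf p b - dens_cdf p a\<bar>" by simp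
    finally show ?thesis using that(1) by simp
  qed
  have "c * \<bar>b - a\<bar> \<le> 2 * \<bar>dens_cdf p b - dens_cdf p a\<bar>"
    using *[OF _ ab] *[OF _ ab(2,1)] by (cases "a \<le> b") (auto simp: abs_minus_commute)
  then show ?thesis using c(1) by (simp add: field_simps)
qed

lemma pos_dens_lower_bound:
  assumes "pos_dens p"
  obtains c where "0 < c" "\<And>t. t \<in> {-1..1} \<Longrightarrow> c \<le> p t"
proof -
  obtain x where "x \<in> {-1..1}" "\<forall>t\<in>{-1..1}. p x \<le> p t"
    using continuous_attains_inf[of "{-1..1}" p] assms by (auto simp: pos_dens_def)
  then show ?thesis using assms by (intro that[of "p x"]) (auto simp: pos_dens_def)
qed

lemma dens_cdf_strict_mono:
  assumes "pos_dens p" "-1 \<le> a" "a < b" "b \<le> 1"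
  shows "dens_cdf p a < dens_cdf p b"
proof -
  obtain c where c: "0 < c" "\<And>t. t \<in> {-1..1} \<Longrightarrow> c \<le> p t"
    using pos_dens_lower_bound assms by blast
  then have "c / 2 * (b - a) \<le> dens_cdf p b - dens_cdf p a"
    using assms by (intro dens_cdf_diff_ge) auto
  moreover have "0 < c / 2 * (b - a)" using c assms by auto
  ultimately show ?thesis by linarith
qed

lemma dens_cdf_le_iff:
  assumes "pos_dens p" "a \<in> {-1..1}" "b \<in> {-1..1}"
  shows "dens_cdf p a \<le> dens_cdf p b \<longleftrightarrow> a \<le> b"
  using dens_cdf_strict_mono[OF assms(1), of a b] dens_cdf_strict_mono[OF assms(1), of b a] assms(2,3)
  by (cases a b rule: linorder_cases) auto

lemma dens_cdf_inj:
  assumes "pos_dens p" "a \<in> {-1..1}" "b \<in> {-1..1}" "dens_cdf p a = dens_cdf p b"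
  shows "a = b"
  using dens_cdf_le_iff[OF assms(1), of a b] dens_cdf_le_iff[OF assms(1), of b a] assms(2-)
  by auto

lemma dens_cdf_range:
  assumes "pos_dens p" "a \<in> {-1..1}"
  shows "dens_cdf p a \<in> {0..1}"
  using dens_cdf_le_iff[OF assms(1), of "-1" a] dens_cdf_le_iff[OF assms(1), of a 1] assms
  by (simp add: dens_cdf_1 dens_cdf_minus_1)

lemma dens_cdf_surj:
  assumes "pos_dens p" "v \<in> {0..1}"
  obtains a where "a \<in> {-1..1}" "dens_cdf p a = v"
  using IVT'[of "dens_cdf p" "-1" v 1] assms
  by (auto simp: dens_cdf_1 dens_cdf_minus_1 continuous_on_dens_cdf)

lemma integrable_mu1:
  fixes g :: "real \<Rightarrow> real"
  assumes "continuous_on {-1..1} g"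
  shows "integrable mu1 g"
proof -
  interpret prob_space mu1 by (rule prob_space_mu1)
  have "compact (g ` {-1..1})"
    by (rule compact_continuous_image[OF assms]) simp
  then obtain B where B: "\<And>x. x \<in> {-1..1} \<Longrightarrow> \<bar>g x\<bar> \<le> B"
    by (force dest!: compact_imp_bounded simp: bounded_iff)
  have "g \<in> borel_measurable mu1"
    using borel_measurable_continuous_on_restrict[OF assms]
    by (simp add: measurable_cong_sets[OF sets_mu1 refl])
  then show ?thesis
    by (intro integrable_const_bound[of _ B]) (auto intro!: AE_I2 B simp: space_mu1)
qed

lemma emeasure_pos_dens:
  assumes p: "pos_dens p" and t: "t \<in> {-1..1}"
  shows "emeasure (density mu1 (\<lambda>s. ennreal (p s))) {-1..t} = ennreal (dens_cdf p t)"
proof -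
  have cp: "continuous_on {-1..1} p" using p by (simp add: pos_dens_def)
  have [measurable]: "p \<in> borel_measurable mu1"
    using integrable_mu1[OF cp] by simp
  have st: "{-1..t} \<in> sets mu1"
    using t by (auto simp: sets_mu1 sets_restrict_space_iff)
  have i: "integrable mu1 (\<lambda>s. indicator {-1..t} s * p s)"
    using integrable_mult_indicator[OF st integrable_mu1[OF cp]] by simp
  have e: "(\<integral>s. indicator {-1..t} s * p s \<partial>mu1) = dens_cdf p t"
    unfolding dens_cdf_def
    by (rule Bochner_Integration.integral_cong) (auto simp: space_mu1 indicator_def)
  have "emeasure (density mu1 (\<lambda>s. ennreal (p s))) {-1..t}
    = (\<integral>\<^sup>+s. ennreal (indicator {-1..t} s * p s) \<partial>mu1)"
    by (subst emeasure_density) (use st in \<open>auto intro!: nn_integral_cong simp: indicator_def\<close>)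
  also have "\<dots> = ennreal (dens_cdf p t)"
    unfolding e[symmetric]
    by (rule nn_integral_eq_integral[OF i], rule AE_I2)
      (use p in \<open>auto simp: space_mu1 pos_dens_def indicator_def intro!: less_imp_le\<close>)
  finally show ?thesis .
qed

text \<open>The intervals starting at -1 determine a probability measure on \<open>[-1,1]\<close>:
  both measures are moved to the real line, where \<open>cdf_unique\<close> applies.\<close>

lemma measure_eqI_atMost_unit:
  assumes M: "prob_space M" "sets M = sets mu1" and N: "prob_space N" "sets N = sets mu1"
    and eq: "\<And>t. t \<in> {-1..1} \<Longrightarrow> emeasure M {-1..t} = emeasure N {-1..t}"
  shows "M = N"
proof (rule measure_eqI)
  have sp: "space M = {-1..1}" "space N = {-1..1}"
    using M(2) N(2) by (auto dest: sets_eq_imp_space_eq simp: space_mu1)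
  have id: "(\<lambda>x. x) \<in> borel_measurable M" "(\<lambda>x. x) \<in> borel_measurable N"
    by (simp_all add: measurable_cong_sets[OF M(2) refl] measurable_cong_sets[OF N(2) refl]
      measurable_cong_sets[OF sets_mu1 refl] measurable_restrict_space1)
  \<comment> \<open>A half-line meets \<open>[-1,1]\<close> in the empty set or in an interval
    ending at \<open>min x 1\<close>.\<close>
  have "emeasure M ({..x} \<inter> {-1..1}) = emeasure N ({..x} \<inter> {-1..1})" for x
  proof (cases "x < -1")
    case False
    then have "{..x} \<inter> {-1..1} = {-1..min x 1}" "min x 1 \<in> {-1..1}" by auto
    then show ?thesis using eq by metis
  next
    case True
    then have "{..x} \<inter> {-1..1} = {}" by auto
    then show ?thesis by simp
  qed
  then have "cdf (distr M borel (\<lambda>x. x)) = cdf (distr N borel (\<lambda>x. x))"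
    using id by (simp add: fun_eq_iff cdf_def measure_def emeasure_distr sp)
  then have *: "distr M borel (\<lambda>x. x) = distr N borel (\<lambda>x. x)"
    by (intro cdf_unique prob_space.real_distribution_distr M N id)
  fix A assume "A \<in> sets M"
  then have A: "A \<in> sets borel" "A \<subseteq> {-1..1}"
    by (auto simp: M(2) sets_mu1 sets_restrict_space_iff)
  show "emeasure M A = emeasure N A"
    using arg_cong[OF *, of "\<lambda>M. emeasure M A"] id A by (simp add: emeasure_distr sp Int_absorb2)
qed (simp add: M N)

section \<open>Existence, uniqueness and derivative of the monotone transport\<close>

lemma prob_space_pos_dens:
  assumes p: "pos_dens p"
  shows "prob_space (density mu1 (\<lambda>s. ennreal (p s)))"
  using emeasure_pos_dens[OF p, of 1] by (intro prob_spaceI) (simp add: space_mu1 dens_cdf_1 p)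

text \<open>Monotonicity puts \<open>{-1..t}\<close> inside the preimage of
  \<open>{-1..S t}\<close>, which gives one inequality. If it were strict, some
  \<open>r < S t\<close> would have its value of \<open>dens_cdf q\<close> strictly in between; by
  monotonicity the preimage of \<open>{-1..r}\<close> lies in \<open>{-1..t}\<close>, so its mass is
  too small.\<close>

lemma mono_transport_unique:
  assumes p: "pos_dens p" and q: "pos_dens q"
  defines "M \<equiv> density mu1 (\<lambda>s. ennreal (p s))" and "N \<equiv> density mu1 (\<lambda>s. ennreal (q s))"
  assumes S: "S \<in> {-1..1} \<rightarrow> {-1..1}" "mono_on {-1..1} S" "S \<in> M \<rightarrow>\<^sub>M N" "distr M N S = N"
    and t: "t \<in> {-1..1}"
  shows "dens_cdf q (S t) = dens_cdf p t"
proof -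
  have sM: "sets M = sets mu1" "sets N = sets mu1" "space M = {-1..1}" by (auto simp: M_def N_def space_mu1)
  have H: "emeasure M (S -` {-1..r} \<inter> {-1..1}) = ennreal (dens_cdf q r)" if r: "r \<in> {-1..1}" for r
  proof -
    have "{-1..r} \<in> sets N" using r by (auto simp: sM sets_mu1 sets_restrict_space_iff)
    then have "emeasure (distr M N S) {-1..r} = emeasure M (S -` {-1..r} \<inter> {-1..1})"
      using S(3) by (simp add: emeasure_distr sM)
    then show ?thesis using emeasure_pos_dens[OF q r] by (simp add: S(4)) (simp add: N_def)
  qed
  have ms: "S -` {-1..r} \<inter> {-1..1} \<in> sets M" if r: "r \<in> {-1..1}" for r
    using measurable_sets[OF S(3), of "{-1..r}"] r by (simp add: sM sets_mu1 sets_restrict_space_iff)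
  have mt: "{-1..t} \<in> sets M" using t by (auto simp: sM sets_mu1 sets_restrict_space_iff)
  have St: "S t \<in> {-1..1}" using S(1) t by auto
  have F: "emeasure M {-1..t} = ennreal (dens_cdf p t)"
    unfolding M_def by (rule emeasure_pos_dens[OF p t])
  have pos: "0 \<le> dens_cdf p t" "dens_cdf q r \<ge> 0" if "r \<in> {-1..1}" for r
    using dens_cdf_range[OF p t] dens_cdf_range[OF q that] by auto
  have "emeasure M {-1..t} \<le> emeasure M (S -` {-1..S t} \<inter> {-1..1})"
    using S(1,2) t by (intro emeasure_mono ms St) (auto simp: mono_on_def)
  then have ge: "dens_cdf p t \<le> dens_cdf q (S t)"
    using H[OF St] pos[OF St] by (simp add: F)
  have "\<not> dens_cdf p t < dens_cdf q (S t)"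
  proof
    assume l: "dens_cdf p t < dens_cdf q (S t)"
    define v where "v = (dens_cdf p t + dens_cdf q (S t)) / 2"
    have v: "dens_cdf p t < v" "v < dens_cdf q (S t)" using l by (auto simp: v_def)
    then obtain r where r: "r \<in> {-1..1}" "dens_cdf q r = v"
      using dens_cdf_surj[OF q, of v] pos[OF St] dens_cdf_range[OF q St] by auto
    then have "r < S t" using v(2) dens_cdf_le_iff[OF q St r(1)] by auto
    then have "emeasure M (S -` {-1..r} \<inter> {-1..1}) \<le> emeasure M {-1..t}"
      using S(2) t by (intro emeasure_mono mt) (force simp: mono_on_def not_le[symmetric])
    then show False using H[OF r(1)] F v pos[OF r(1)] r by (simp add: not_le)
  qed
  with ge show ?thesis by simp
qed

text \<open>The equation for the distribution functions turns \<open>S a \<le> b\<close> into a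
  comparison of their values, so the preimage of \<open>{-1..b}\<close> is \<open>{-1..a}\<close>
  with \<open>dens_cdf p a = dens_cdf q b\<close>. The two image masses then agree on these
  intervals.\<close>

lemma mono_transport_exists:
  assumes p: "pos_dens p" and q: "pos_dens q"
    and S: "S \<in> {-1..1} \<rightarrow> {-1..1}" "\<And>t. t \<in> {-1..1} \<Longrightarrow> dens_cdf q (S t) = dens_cdf p t"
  defines "M \<equiv> density mu1 (\<lambda>s. ennreal (p s))" and "N \<equiv> density mu1 (\<lambda>s. ennreal (q s))"
  shows "mono_on {-1..1} S" "S \<in> M \<rightarrow>\<^sub>M N" "distr M N S = N"
proof -
  have sM: "sets M = sets mu1" "sets N = sets mu1" "space M = {-1..1}" by (auto simp: M_def N_def space_mu1)
  have le: "S a \<le> b \<longleftrightarrow> dens_cdf p a \<le> dens_cdf q b" if "a \<in> {-1..1}" "b \<in> {-1..1}" for a b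
  proof -
    have "S a \<in> {-1..1}" using that S(1) by auto
    from dens_cdf_le_iff[OF q this that(2)] S(2)[OF that(1)] show ?thesis by simp
  qed
  show mono: "mono_on {-1..1} S"
  proof (rule mono_onI)
    fix r s :: real assume *: "r \<in> {-1..1}" "s \<in> {-1..1}" "r \<le> s"
    then have "S s \<in> {-1..1}" using S(1) by auto
    then show "S r \<le> S s"
      using * dens_cdf_le_iff[OF p *(1,2)] by (simp add: le S(2))
  qed
  show meas: "S \<in> M \<rightarrow>\<^sub>M N"
    unfolding measurable_cong_sets[OF sM(1,2)] measurable_cong_sets[OF sets_mu1 sets_mu1]
    by (rule measurable_restrict_space2)
      (use S(1) in \<open>auto intro!: borel_measurable_mono_on_fnc mono simp: space_restrict_space\<close>)
  show "distr M N S = N"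
  proof (rule measure_eqI_atMost_unit)
    show "prob_space N" unfolding N_def by (rule prob_space_pos_dens[OF q])
    show "prob_space (distr M N S)"
      using prob_space_pos_dens[OF p] meas unfolding M_def[symmetric] by (rule prob_space.prob_space_distr)
    fix b :: real assume b: "b \<in> {-1..1}"
    obtain a where a: "a \<in> {-1..1}" "dens_cdf p a = dens_cdf q b"
      using dens_cdf_surj[OF p dens_cdf_range[OF q b]] by metis
    have "S -` {-1..b} \<inter> {-1..1} = {-1..a}"
      using S(1) b a(1) le[OF _ b] dens_cdf_le_iff[OF p _ a(1)] by (auto simp: a(2)[symmetric])
    moreover have "{-1..b} \<in> sets N" using b by (auto simp: sM sets_mu1 sets_restrict_space_iff)
    ultimately have "emeasure (distr M N S) {-1..b} = emeasure M {-1..a}"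
      using meas by (simp add: emeasure_distr sM)
    then show "emeasure (distr M N S) {-1..b} = emeasure N {-1..b}"
      using emeasure_pos_dens[OF p a(1)] emeasure_pos_dens[OF q b] a(2) by (simp add: M_def N_def)
  qed (simp_all add: sM)
qed

text \<open>The transport is the inverse of \<open>dens_cdf q\<close> applied to
  \<open>dens_cdf p\<close>. This shows that the definite description in
  \<open>monotone_transport\<close> is proper, so its properties can be read off.\<close>

lemma monotone_transport:
  assumes p: "pos_dens p" and q: "pos_dens q"
  defines "M \<equiv> density mu1 (\<lambda>s. ennreal (p s))" and "N \<equiv> density mu1 (\<lambda>s. ennreal (q s))"
  defines "S \<equiv> monotone_transport M N"
  shows monotone_transport_range: "t \<in> {-1..1} \<Longrightarrow> S t \<in> {-1..1}"
    and dens_cdf_monotone_transport: "t \<in> {-1..1} \<Longrightarrow> dens_cdf q (S t) = dens_cdf p t"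
    and measurable_monotone_transport: "S \<in> M \<rightarrow>\<^sub>M N"
    and distr_monotone_transport: "distr M N S = N"
proof -
  let ?P = "\<lambda>S. S \<in> {-1..1} \<rightarrow>\<^sub>E {-1..1} \<and> mono_on {-1..1} S \<and> S \<in> M \<rightarrow>\<^sub>M N \<and> distr M N S = N"
  have "\<exists>s\<in>{-1..1}. dens_cdf q s = dens_cdf p t" if "t \<in> {-1..1}" for t
    using dens_cdf_surj[OF q dens_cdf_range[OF p that]] by blast
  then obtain S0 where S0: "\<And>t. t \<in> {-1..1} \<Longrightarrow> S0 t \<in> {-1..1} \<and> dens_cdf q (S0 t) = dens_cdf p t"
    by metis
  define S1 where "S1 = restrict S0 {-1..1}"
  have S1: "S1 \<in> {-1..1} \<rightarrow>\<^sub>E {-1..1}" "\<And>t. t \<in> {-1..1} \<Longrightarrow> dens_cdf q (S1 t) = dens_cdf p t"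
    using S0 by (auto simp: S1_def)
  then have "?P S1"
    using mono_transport_exists[OF p q, of S1] by (auto simp: M_def N_def)
  moreover have "S' = S1" if "?P S'" for S'
  proof
    fix t show "S' t = S1 t"
    proof (cases "t \<in> {-1..1}")
      case True
      \<comment> \<open>Equality holds at every point and not merely almost everywhere, because
        \<open>dens_cdf q\<close> is injective.\<close>
      then have "dens_cdf q (S' t) = dens_cdf q (S1 t)"
        using that mono_transport_unique[OF p q, of S' t] S1(2) by (auto simp: M_def N_def)
      then show ?thesis using dens_cdf_inj[OF q, of "S' t" "S1 t"] that S1(1) True by blast
    next
      case False
      have "S' t = undefined" "S1 t = undefined"
        using that S1(1) False by (auto dest: PiE_arb)
      then show ?thesis by simp
    qed
  qed
  ultimately have eq: "S = S1" unfolding S_def monotone_transport_def by (intro the_equality) blast+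
  show "t \<in> {-1..1} \<Longrightarrow> S t \<in> {-1..1}" "t \<in> {-1..1} \<Longrightarrow> dens_cdf q (S t) = dens_cdf p t"
    "S \<in> M \<rightarrow>\<^sub>M N" "distr M N S = N"
    using S1 \<open>?P S1\<close> unfolding eq by auto
qed

text \<open>In Caratheodory form the increments of the two distribution functions are
  \<open>h (S s) * (S s - S t)\<close> and \<open>g s * (s - t)\<close>, and they are equal.
  Dividing by \<open>h (S s)\<close> and letting \<open>s\<close> tend to \<open>t\<close> gives the
  derivative, once \<open>S\<close> is continuous at \<open>t\<close>; the end points need no
  separate case, and the factors 1/2 cancel.\<close>

lemma has_derivative_monotone_transport:
  assumes p: "pos_dens p" and q: "pos_dens q" and t: "t \<in> {-1..1}"
  defines "S \<equiv> monotone_transport (density mu1 (\<lambda>s. ennreal (p s))) (density mu1 (\<lambda>s. ennreal (q s)))"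
  shows "(S has_real_derivative p t / q (S t)) (at t within {-1..1})"
proof -
  have S: "S s \<in> {-1..1}" "dens_cdf q (S s) = dens_cdf p s" if "s \<in> {-1..1}" for s
    using monotone_transport[OF p q] that by (auto simp: S_def)
  obtain c where c: "0 < c" "\<And>t. t \<in> {-1..1} \<Longrightarrow> c \<le> q t"
    using pos_dens_lower_bound[OF q] by blast
  obtain h where h: "\<And>z. dens_cdf q z - dens_cdf q (S t) = h z * (z - S t)"
    "continuous (at (S t) within {-1..1}) h" "h (S t) = q (S t) / 2"
    using dens_cdf_has_derivative[OF q S(1)[OF t]] unfolding DERIV_caratheodory_within by blast
  obtain g where g: "\<And>z. dens_cdf p z - dens_cdf p t = g z * (z - t)"
    "continuous (at t within {-1..1}) g" "g t = p t / 2"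
    using dens_cdf_has_derivative[OF p t] unfolding DERIV_caratheodory_within by blast
  have qp: "0 < q (S t)" using q S(1)[OF t] by (auto simp: pos_dens_def)
  \<comment> \<open>Away from \<open>S t\<close> a zero would contradict injectivity of
    \<open>dens_cdf q\<close>; at \<open>S t\<close> the value is \<open>q (S t) / 2\<close>, which
    is positive.\<close>
  have h0: "h z \<noteq> 0" if "z \<in> {-1..1}" for z
  proof
    assume "h z = 0"
    then have "dens_cdf q z = dens_cdf q (S t)" using h(1)[of z] by simp
    then have "z = S t" by (rule dens_cdf_inj[OF q that S(1)[OF t]])
    then show False using h(3) qp \<open>h z = 0\<close> by simp
  qed
  have "continuous (at t within {-1..1}) S"
  proof -
    have lip: "\<bar>S s - S t\<bar> \<le> 2 / c * \<bar>dens_cdf p s - dens_cdf p t\<bar>" if s: "s \<in> {-1..1}" for s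
      using dens_cdf_abs_diff_ge[OF q c S(1)[OF t] S(1)[OF s]] unfolding S(2)[OF s] S(2)[OF t] .
    have lim: "((\<lambda>s. 2 / c * \<bar>dens_cdf p s - dens_cdf p t\<bar>) \<longlongrightarrow> 2 / c * \<bar>dens_cdf p t - dens_cdf p t\<bar>) (at t within {-1..1})"
      using continuous_on_dens_cdf[OF p] t unfolding continuous_on_def by (intro tendsto_intros) blast
    have "eventually (\<lambda>s. norm (S s - S t) \<le> 2 / c * \<bar>dens_cdf p s - dens_cdf p t\<bar>) (at t within {-1..1})"
      unfolding eventually_at_filter real_norm_def by (intro always_eventually allI impI lip)
    then have "((\<lambda>s. S s - S t) \<longlongrightarrow> 0) (at t within {-1..1})"
      by (rule Lim_null_comparison) (use lim in \<open>simp only: diff_self abs_zero mult_zero_right\<close>)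
    then show ?thesis by (simp add: continuous_within LIM_zero_iff)
  qed
  then have "continuous (at t within {-1..1}) (\<lambda>s. h (S s))"
    by (rule continuous_within_compose2) (use h(2) S(1) in \<open>auto intro: continuous_within_subset\<close>)
  then have cont: "((\<lambda>s. g s / h (S s)) \<longlongrightarrow> g t / h (S t)) (at t within {-1..1})"
    using g(2) h0[OF S(1)[OF t]] unfolding continuous_within by (intro tendsto_divide)
  have eq: "S s - S t = g s / h (S s) * (s - t)" if "s \<in> {-1..1}" for s
    using h(1)[of "S s"] g(1)[of s] S(2)[OF that] S(2)[OF t] h0[OF S(1)[OF that]]
    by (simp add: field_simps)
  have "((\<lambda>s. (S s - S t) / (s - t)) \<longlongrightarrow> g t / h (S t)) (at t within {-1..1})"
    by (rule Lim_transform_within[OF cont zero_less_one]) (use eq in auto)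
  then show ?thesis
    using g(3) h(3) by (simp add: has_field_derivative_iff)
qed

section \<open>Marginal and conditional densities\<close>

lemma cubeN_iff: "y \<in> cubeN \<longleftrightarrow> (\<forall>j. y j \<in> {-1..1})"
  by (auto simp: cubeN_def)

lemma cubeN_upd: "y \<in> cubeN \<Longrightarrow> s \<in> {-1..1} \<Longrightarrow> y(k := s) \<in> cubeN"
  by (simp add: cubeN_iff)

lemma cubeN_comb_seq: "y \<in> cubeN \<Longrightarrow> t \<in> cubeN \<Longrightarrow> comb_seq k y t \<in> cubeN"
  by (simp add: cubeN_iff comb_seq_def)

lemma compact_cubeN: "compact cubeN"
proof -
  have "compactin (product_topology (\<lambda>i::nat. euclidean :: real topology) UNIV) (UNIV \<rightarrow>\<^sub>E {-1..1})"
    unfolding compactin_PiE by simp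
  then show ?thesis
    unfolding cubeN_def euclidean_product_topology compactin_euclidean_iff .
qed

lemma prob_space_mu: "prob_space mu"
  unfolding mu_def by (rule prob_space_PiM) (rule prob_space_mu1)

lemma sequence_space_mu1: "sequence_space mu1"
proof -
  interpret prob_space mu1 by (rule prob_space_mu1)
  show ?thesis by unfold_locales
qed

lemma borel_measurable_mu_continuous_on:
  fixes g :: "(nat \<Rightarrow> real) \<Rightarrow> 'a::topological_space"
  assumes "continuous_on cubeN g"
  shows "g \<in> borel_measurable mu"
  using borel_measurable_continuous_on_restrict[OF assms]
  by (simp add: measurable_cong_sets[OF sets_mu refl])

text \<open>This discards the jump of the indicator \<open>{..y k}\<close> in the continuity proof
  for \<open>cond_cdf\<close>.\<close>

lemma AE_mu1_neq: "AE s in mu1. s \<noteq> c"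
proof -
  have "AE s in restrict_space lborel {-1..1}. s \<noteq> c"
    using AE_lborel_singleton[of c] by (subst AE_restrict_space_iff) auto
  then show ?thesis
    unfolding mu1_eq_density by (subst AE_density) auto
qed

lemma continuous_on_component: "continuous_on A (\<lambda>y. y (j :: 'b) :: 'a::topological_space)"
  by (rule continuous_on_subset[OF continuous_on_product_coordinates]) simp

lemma continuous_on_fun_upd:
  fixes g :: "'c::topological_space \<Rightarrow> 'b \<Rightarrow> 'a::topological_space"
  assumes "continuous_on A g" "continuous_on A h"
  shows "continuous_on A (\<lambda>y. (g y)(k := h y))"
proof (rule continuous_on_coordinatewise_then_product)
  fix i
  have "continuous_on A (\<lambda>y. g y i)"
    by (rule continuous_on_compose2[OF continuous_on_component assms(1)]) auto
  then show "continuous_on A (\<lambda>y. ((g y)(k := h y)) i)" using assms(2) by (cases "i = k") auto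
qed

lemma continuous_on_comb_seq:
  "continuous_on A (\<lambda>y. comb_seq k y (t :: nat \<Rightarrow> 'a::topological_space))"
proof (rule continuous_on_coordinatewise_then_product)
  show "continuous_on A (\<lambda>y. comb_seq k y t i)" for i
    by (cases "i < k") (simp_all add: comb_seq_def continuous_on_component)
qed

text \<open>Dominated convergence along sequences, with a constant as majorant. The exceptional null
  set may depend on \<open>y\<close>, so integrands with a jump whose position moves with
  \<open>y\<close> are covered.\<close>

lemma continuous_on_integral_bounded:
  fixes h :: "'a::metric_space \<Rightarrow> 'b \<Rightarrow> real"
  assumes M: "prob_space M"
    and meas: "\<And>y. y \<in> A \<Longrightarrow> h y \<in> borel_measurable M"
    and bound: "\<And>y t. y \<in> A \<Longrightarrow> t \<in> space M \<Longrightarrow> \<bar>h y t\<bar> \<le> B"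
    and cont: "\<And>y. y \<in> A \<Longrightarrow> AE t in M. continuous (at y within A) (\<lambda>z. h z t)"
  shows "continuous_on A (\<lambda>y. \<integral>t. h y t \<partial>M)"
  unfolding continuous_on_sequentially
proof (intro allI ballI impI, elim conjE)
  interpret prob_space M by fact
  fix x y assume y: "y \<in> A" and x: "\<forall>n. x n \<in> A" "x \<longlonglongrightarrow> y"
  show "((\<lambda>y. \<integral>t. h y t \<partial>M) \<circ> x) \<longlonglongrightarrow> (\<integral>t. h y t \<partial>M)"
    unfolding o_def
  proof (rule integral_dominated_convergence[where w="\<lambda>_. B"])
    show "AE t in M. (\<lambda>n. h (x n) t) \<longlonglongrightarrow> h y t"
      using cont[OF y]
    proof eventually_elim
      case (elim t)
      from continuous_within_tendsto_compose'[OF this] x show ?case by blast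
    qed
    show "AE t in M. norm (h (x n) t) \<le> B" for n
      using bound x(1) by (intro AE_I2) auto
  qed (use meas x(1) y in auto)
qed

text \<open>\<open>comb_seq k\<close> reads only the first \<open>k\<close> coordinates. Truncations
  can therefore be dropped, and the arguments below work with points of \<open>cubeN\<close> instead
  of \<open>cube k\<close>.\<close>

lemma marg_cong:
  assumes "\<And>j. j < k \<Longrightarrow> y j = y' j"
  shows "marg f k y = marg f k y'"
proof -
  have "comb_seq k y = comb_seq k y'" using assms by (auto simp: comb_seq_def fun_eq_iff)
  then show ?thesis by (simp add: marg_def)
qed

lemma cond_dens_Suc: "cond_dens f (Suc k) (y(k := s)) = marg f (Suc k) (y(k := s)) / marg f k y"
  using marg_cong[of k "trunc k (y(k := s))" y f] by (simp add: cond_dens_def)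

definition cond_cdf :: "((nat \<Rightarrow> real) \<Rightarrow> real) \<Rightarrow> nat \<Rightarrow> (nat \<Rightarrow> real) \<Rightarrow> real" where
  "cond_cdf f k y = dens_cdf (\<lambda>s. cond_dens f (Suc k) (y(k := s))) (y k)"

lemma cond_measure_cong:
  assumes "\<And>j. j < k \<Longrightarrow> y j = y' j"
  shows "cond_measure f k y = cond_measure f k y'"
proof -
  have "marg f (Suc k) (y(k := s)) = marg f (Suc k) (y'(k := s))" for s
    by (rule marg_cong) (use assms in auto)
  moreover have "marg f k y = marg f k y'" by (rule marg_cong) (fact assms)
  ultimately show ?thesis by (simp add: cond_measure_def cond_dens_Suc)
qed

text \<open>The metric on sequences is controlled by the coordinates \<open>from_nat n\<close> with
  \<open>n \<le> N\<close>, up to \<open>(1/2) ^ N\<close>. Taking \<open>K\<close> beyond all these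
  indices makes those coordinates agree, uniformly in \<open>y\<close> and \<open>t\<close>.\<close>

lemma comb_seq_dist_uniform:
  fixes y t :: "nat \<Rightarrow> 'a::metric_space"
  assumes "0 < e"
  obtains K where "\<And>k (y :: nat \<Rightarrow> 'a) t. K \<le> k \<Longrightarrow> dist (comb_seq k y t) y < e"
proof -
  obtain N where N: "(1/2::real) ^ N < e"
    using real_arch_pow_inv[OF assms, of "1/2"] by auto
  define K where "K = Suc (Max (from_nat ` {..N}))"
  show thesis
  proof (rule that)
    fix k and y t :: "nat \<Rightarrow> 'a" assume "K \<le> k"
    have "from_nat n < k" if "n \<le> N" for n :: nat
    proof -
      have "from_nat n \<le> Max (from_nat ` {..N} :: nat set)" using that by (intro Max_ge) auto
      then show ?thesis using \<open>K \<le> k\<close> by (simp add: K_def)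
    qed
    then have "{dist (comb_seq k y t (from_nat n)) (y (from_nat n)) |n. n \<le> N} = {0}"
      by (auto simp: comb_seq_def) 
    then show "dist (comb_seq k y t) y < e"
      using dist_fun_le_dist_first_terms[of "comb_seq k y t" y N] N by simp
  qed
qed

section \<open>Marginals and conditionals of one continuous positive density\<close>

locale pos_density =
  fixes f :: "(nat \<Rightarrow> real) \<Rightarrow> real"
  assumes cont: "continuous_on cubeN f"
    and pos: "y \<in> cubeN \<Longrightarrow> 0 < f y"
    and int_1: "(\<integral>y. f y \<partial>mu) = 1"
begin

lemma bounds:
  obtains c B where "0 < c" "\<And>y. y \<in> cubeN \<Longrightarrow> c \<le> f y" "\<And>y. y \<in> cubeN \<Longrightarrow> f y \<le> B"
proof -
  have ne: "cubeN \<noteq> {}" using cubeN_iff[of "\<lambda>_. 0"] by auto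
  obtain x where "x \<in> cubeN" "\<forall>y\<in>cubeN. f x \<le> f y"
    using continuous_attains_inf[OF compact_cubeN ne cont] by blast
  moreover obtain z where "z \<in> cubeN" "\<forall>y\<in>cubeN. f y \<le> f z"
    using continuous_attains_sup[OF compact_cubeN ne cont] by blast
  ultimately show ?thesis using that[of "f x" "f z"] pos by auto
qed

lemma measurable_f [measurable]: "f \<in> borel_measurable mu"
  by (rule borel_measurable_mu_continuous_on[OF cont])

text \<open>For \<open>k = 0\<close> the value 1 fixed in \<open>marg\<close> is the total mass of
  \<open>f\<close>, so the case distinction disappears.\<close>

lemma marg_eq: "marg f k y = (\<integral>t. f (comb_seq k y t) \<partial>mu)"
  by (simp add: marg_def int_1 comb_seq_0)

lemma continuous_on_f_comb_seq: "y \<in> cubeN \<Longrightarrow> continuous_on cubeN (\<lambda>t. f (comb_seq k y t))"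
proof (rule continuous_on_compose2[OF cont])
  show "continuous_on cubeN (comb_seq k y)"
  proof (rule continuous_on_coordinatewise_then_product)
    show "continuous_on cubeN (\<lambda>t. comb_seq k y t i)" for i
      by (cases "i < k") (simp_all add: comb_seq_def continuous_on_component)
  qed
qed (auto intro: cubeN_comb_seq)

lemma integrable_f_comb_seq: "y \<in> cubeN \<Longrightarrow> integrable mu (\<lambda>t. f (comb_seq k y t))"
proof -
  interpret prob_space mu by (rule prob_space_mu)
  assume y: "y \<in> cubeN"
  obtain c B where B: "0 < c" "\<And>y. y \<in> cubeN \<Longrightarrow> c \<le> f y" "\<And>y. y \<in> cubeN \<Longrightarrow> f y \<le> B" using bounds by blast
  have "\<bar>f (comb_seq k y t)\<bar> \<le> B" if "t \<in> cubeN" for t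
    using pos[OF cubeN_comb_seq[OF y that], of k] B(3)[OF cubeN_comb_seq[OF y that], of k] by simp
  then show ?thesis
    by (intro integrable_const_bound[of _ B] borel_measurable_mu_continuous_on continuous_on_f_comb_seq y)
      (auto simp: space_mu intro!: AE_I2)
qed

lemma marg_bounds:
  assumes "\<And>y. y \<in> cubeN \<Longrightarrow> c \<le> f y" "\<And>y. y \<in> cubeN \<Longrightarrow> f y \<le> B" and y: "y \<in> cubeN"
  shows "c \<le> marg f k y" "marg f k y \<le> B"
proof -
  interpret prob_space mu by (rule prob_space_mu)
  show "c \<le> marg f k y" unfolding marg_eq
    by (rule integral_ge_const[OF integrable_f_comb_seq[OF y]])
      (intro AE_I2 assms cubeN_comb_seq, simp_all add: space_mu y)
  show "marg f k y \<le> B" unfolding marg_eq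
    by (rule integral_le_const[OF integrable_f_comb_seq[OF y]])
      (intro AE_I2 assms cubeN_comb_seq, simp_all add: space_mu y)
qed

lemma marg_pos: "y \<in> cubeN \<Longrightarrow> 0 < marg f k y"
  using bounds marg_bounds(1) less_le_trans by metis

lemma continuous_on_marg: "continuous_on cubeN (marg f k)"
  unfolding marg_eq[abs_def]
proof -
  obtain c B where B: "0 < c" "\<And>y. y \<in> cubeN \<Longrightarrow> c \<le> f y" "\<And>y. y \<in> cubeN \<Longrightarrow> f y \<le> B" using bounds by blast
  show "continuous_on cubeN (\<lambda>y. \<integral>t. f (comb_seq k y t) \<partial>mu)"
  proof (rule continuous_on_integral_bounded[OF prob_space_mu, of _ _ B])
    fix y assume y: "y \<in> cubeN"
    show "(\<lambda>t. f (comb_seq k y t)) \<in> borel_measurable mu"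
      by (intro borel_measurable_mu_continuous_on continuous_on_f_comb_seq y)
    show "AE t in mu. continuous (at y within cubeN) (\<lambda>z. f (comb_seq k z t))"
    proof (rule AE_I2)
      fix t assume t: "t \<in> space mu"
      have "continuous_on cubeN (\<lambda>z. f (comb_seq k z t))"
        by (rule continuous_on_compose2[OF cont continuous_on_comb_seq])
          (use t in \<open>auto simp: space_mu intro: cubeN_comb_seq\<close>)
      then show "continuous (at y within cubeN) (\<lambda>z. f (comb_seq k z t))"
        using y by (simp add: continuous_on_eq_continuous_within)
    qed
    fix t assume "t \<in> space mu"
    then have "comb_seq k y t \<in> cubeN" using y by (simp add: space_mu cubeN_comb_seq)
    then show "\<bar>f (comb_seq k y t)\<bar> \<le> B" using pos B(3) by (simp add: less_imp_le)
  qed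
qed

text \<open>Prepending an independent \<open>mu1\<close> coordinate to a \<open>mu\<close> sequence
  gives \<open>mu\<close> again; Fubini then separates the coordinate \<open>k\<close> from the
  later ones.\<close>

lemma integral_marg_Suc:
  assumes y: "y \<in> cubeN"
  shows "(\<integral>s. marg f (Suc k) (y(k := s)) \<partial>mu1) = marg f k y"
proof -
  interpret sequence_space mu1 by (rule sequence_space_mu1)
  interpret m1: prob_space mu1 by (rule prob_space_mu1)
  interpret m: prob_space mu by (rule prob_space_mu)
  interpret P2: pair_prob_space mu1 mu ..
  have case_nat[measurable]: "(\<lambda>(s, \<omega>). case_nat s \<omega>) \<in> mu1 \<Otimes>\<^sub>M mu \<rightarrow>\<^sub>M mu"
    unfolding mu_def by measurable
  have fc[measurable]: "(\<lambda>t. f (comb_seq k y t)) \<in> borel_measurable mu"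
    by (intro borel_measurable_mu_continuous_on continuous_on_f_comb_seq y)
  have d: "distr (mu1 \<Otimes>\<^sub>M mu) mu (\<lambda>(s, \<omega>). case_nat s \<omega>) = mu"
    unfolding mu_def by (rule PiM_iter)
  have i: "integrable (mu1 \<Otimes>\<^sub>M mu) (\<lambda>(s, \<omega>). f (comb_seq k y (case_nat s \<omega>)))"
    using integrable_f_comb_seq[OF y, of k] integrable_distr_eq[OF case_nat fc]
    unfolding d by (simp add: case_prod_unfold)
  \<comment> \<open>The value \<open>s\<close> can be seen as the last retained coordinate or as the
    head of the appended tail.\<close>
  have e: "comb_seq (Suc k) (y(k := s)) t = comb_seq k y (case_nat s t)" for s t
    by (simp add: comb_seq_Suc) (auto simp: comb_seq_def)
  have "marg f k y = (\<integral>w. f (comb_seq k y w) \<partial>distr (mu1 \<Otimes>\<^sub>M mu) mu (\<lambda>(s, \<omega>). case_nat s \<omega>))"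
    by (simp only: d marg_eq)
  also have "\<dots> = (\<integral>x. (case x of (s, \<omega>) \<Rightarrow> f (comb_seq k y (case_nat s \<omega>))) \<partial>(mu1 \<Otimes>\<^sub>M mu))"
    by (subst integral_distr[OF case_nat fc]) (simp add: case_prod_unfold)
  also have "\<dots> = (\<integral>s. (\<integral>w. f (comb_seq k y (case_nat s w)) \<partial>mu) \<partial>mu1)"
    using P2.integral_fst'[OF i] by simp
  finally show ?thesis by (simp add: marg_eq e)
qed

lemma continuous_on_marg_upd:
  assumes "y \<in> cubeN"
  shows "continuous_on {-1..1} (\<lambda>s. marg f (Suc k) (y(k := s)))"
  by (rule continuous_on_compose2[OF continuous_on_marg])
    (use assms in \<open>auto intro!: continuous_on_fun_upd cubeN_upd\<close>)

text \<open>The total mass is 1 because integrating out the coordinate \<open>k\<close> turns one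
  marginal into the preceding one. The one-dimensional transport results thereby apply to every
  conditional law.\<close>

lemma pos_dens_cond:
  assumes y: "y \<in> cubeN"
  shows "pos_dens (\<lambda>s. cond_dens f (Suc k) (y(k := s)))"
  unfolding pos_dens_def cond_dens_Suc
  using marg_pos[OF y, of k] integral_marg_Suc[OF y, of k]
  by (auto intro!: continuous_on_divide continuous_on_marg_upd marg_pos cubeN_upd y divide_pos_pos)

lemma cond_dens_lower_bound:
  obtains c where "0 < c" "\<And>y k. y \<in> cubeN \<Longrightarrow> c \<le> cond_dens f (Suc k) y"
    "\<And>y k. y \<in> cubeN \<Longrightarrow> cond_dens f (Suc k) y \<le> 1 / c"
proof -
  obtain c B where B: "0 < c" "\<And>y. y \<in> cubeN \<Longrightarrow> c \<le> f y" "\<And>y. y \<in> cubeN \<Longrightarrow> f y \<le> B" using bounds by blast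
  have "(\<lambda>_. 0) \<in> cubeN" by (simp add: cubeN_iff)
  then have "0 < B" using B order_trans less_le_trans by metis
  show ?thesis
  \<comment> \<open>All marginals lie between the bounds \<open>c\<close> and \<open>B\<close> of
    \<open>f\<close>, so their quotients lie between \<open>c / B\<close> and
    \<open>B / c\<close>.\<close>
  proof (rule that[of "c / B"])
    fix y k assume y: "y \<in> cubeN"
    have e: "cond_dens f (Suc k) y = marg f (Suc k) y / marg f k y"
      using cond_dens_Suc[of f k y "y k"] by simp
    note b = marg_bounds[OF B(2,3) y] marg_pos[OF y]
    show "c / B \<le> cond_dens f (Suc k) y"
      unfolding e using b B(1) less_imp_le[OF b(3)] by (intro frac_le) auto
    have "marg f (Suc k) y / marg f k y \<le> B / c"
      using b B(1) less_imp_le[OF b(3)] \<open>0 < B\<close> by (intro frac_le) auto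
    then show "cond_dens f (Suc k) y \<le> 1 / (c / B)" unfolding e by simp
  qed (use B \<open>0 < B\<close> in auto)
qed

lemma continuous_on_cond_dens: "continuous_on cubeN (cond_dens f (Suc k))"
proof -
  have "cond_dens f (Suc k) = (\<lambda>y. marg f (Suc k) y / marg f k y)"
    using cond_dens_Suc[of f k y "y k" for y] by (simp add: fun_eq_iff)
  then show ?thesis
    using marg_pos by (auto intro!: continuous_on_divide continuous_on_marg) (metis less_irrefl)
qed

text \<open>For fixed \<open>s\<close> different from \<open>y k\<close> the indicator is constant
  in \<open>z\<close> near \<open>y\<close> and the conditional density is continuous. The remaining
  point is a null set, and the densities are bounded uniformly.\<close>

lemma continuous_on_cond_cdf: "continuous_on cubeN (cond_cdf f k)"
  unfolding cond_cdf_def[abs_def] dens_cdf_def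
proof -
  obtain c where c: "0 < c" "\<And>y k. y \<in> cubeN \<Longrightarrow> c \<le> cond_dens f (Suc k) y"
    "\<And>y k. y \<in> cubeN \<Longrightarrow> cond_dens f (Suc k) y \<le> 1 / c" using cond_dens_lower_bound by blast
  let ?h = "\<lambda>y s. indicator {..y k} s * cond_dens f (Suc k) (y(k := s))"
  show "continuous_on cubeN (\<lambda>y. \<integral>s. ?h y s \<partial>mu1)"
  proof (rule continuous_on_integral_bounded[OF prob_space_mu1, of _ _ "1 / c"])
    fix y assume y: "y \<in> cubeN"
    have "(\<lambda>s. cond_dens f (Suc k) (y(k := s))) \<in> borel_measurable mu1"
      using integrable_mu1[of "\<lambda>s. cond_dens f (Suc k) (y(k := s))"] pos_dens_cond[OF y]
      by (auto simp: pos_dens_def)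
    moreover have "indicator {..y k} \<in> borel_measurable mu1"
      by (simp add: measurable_cong_sets[OF sets_mu1 refl] measurable_restrict_space1)
    ultimately show "?h y \<in> borel_measurable mu1" by (rule borel_measurable_times[rotated])
    show "AE s in mu1. continuous (at y within cubeN) (\<lambda>z. ?h z s)"
      using AE_mu1_neq[of "y k"] AE_space
    proof eventually_elim
      case (elim s)
      have yk: "((\<lambda>z. z k) \<longlongrightarrow> y k) (at y within cubeN)"
        using continuous_on_component[of cubeN k] y by (simp add: continuous_on_def)
      have "eventually (\<lambda>z. indicator {..z k} s = (indicator {..y k} s :: real)) (at y within cubeN)"
      proof (cases "s < y k")
        case True
        from order_tendstoD(1)[OF yk this] show ?thesis
          by eventually_elim (use True in auto)
      next
        case False
        then have "y k < s" using elim(1) by auto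
        from order_tendstoD(2)[OF yk this] show ?thesis
          by eventually_elim (use \<open>y k < s\<close> in auto)
      qed
      then have "((\<lambda>z. indicator {..z k} s) \<longlongrightarrow> (indicator {..y k} s :: real)) (at y within cubeN)"
        by (rule tendsto_eventually)
      moreover have "continuous_on cubeN (\<lambda>z. cond_dens f (Suc k) (z(k := s)))"
        by (rule continuous_on_compose2[OF continuous_on_cond_dens])
          (use elim(2) in \<open>auto simp: space_mu1 intro!: continuous_on_fun_upd cubeN_upd continuous_on_id\<close>)
      then have "((\<lambda>z. cond_dens f (Suc k) (z(k := s))) \<longlongrightarrow> cond_dens f (Suc k) (y(k := s))) (at y within cubeN)"
        using y by (auto simp: continuous_on_def)
      ultimately show ?case unfolding continuous_within by (rule tendsto_mult)
    qed
    fix s assume "s \<in> space mu1"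
    then have "y(k := s) \<in> cubeN" using y by (simp add: space_mu1 cubeN_upd)
    from c(2)[OF this, of k] c(3)[OF this, of k] c(1) show "\<bar>?h y s\<bar> \<le> 1 / c"
      by (auto simp: indicator_def)
  qed
qed

lemma uniform_limit_marg: "uniform_limit cubeN (marg f) f sequentially"
proof (rule uniform_limitI)
  fix e :: real assume e: "0 < e"
  have "uniformly_continuous_on cubeN f" by (rule compact_uniformly_continuous[OF cont compact_cubeN])
  \<comment> \<open>Averaging over \<open>t\<close> is done with weak inequalities; the bound
    \<open>e / 2\<close> restores strictness at the end.\<close>
  then obtain d where d: "0 < d" "\<And>x y. x \<in> cubeN \<Longrightarrow> y \<in> cubeN \<Longrightarrow> dist x y < d \<Longrightarrow> dist (f x) (f y) < e / 2"
    unfolding uniformly_continuous_on_def using e by (metis half_gt_zero)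
  obtain K where K: "\<And>k (y :: nat \<Rightarrow> real) t. K \<le> k \<Longrightarrow> dist (comb_seq k y t) y < d"
    using comb_seq_dist_uniform[OF d(1)] by blast
  interpret prob_space mu by (rule prob_space_mu)
  have "dist (marg f k y) (f y) < e" if k: "K \<le> k" and y: "y \<in> cubeN" for k y
  proof -
    have b: "f (comb_seq k y t) \<le> f y + e / 2" "f y - e / 2 \<le> f (comb_seq k y t)"
      if "t \<in> space mu" for t
    proof -
      have "dist (f (comb_seq k y t)) (f y) < e / 2"
        by (intro d(2) cubeN_comb_seq y that[unfolded space_mu] K k)
      then have "\<bar>f (comb_seq k y t) - f y\<bar> < e / 2" by (simp only: dist_real_def)
      then show "f (comb_seq k y t) \<le> f y + e / 2" "f y - e / 2 \<le> f (comb_seq k y t)"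
        by linarith+
    qed
    have "marg f k y \<le> f y + e / 2" unfolding marg_eq
      by (rule integral_le_const[OF integrable_f_comb_seq[OF y]])
        (intro AE_I2 b)
    moreover have "f y - e / 2 \<le> marg f k y" unfolding marg_eq
      by (rule integral_ge_const[OF integrable_f_comb_seq[OF y]])
        (intro AE_I2 b)
    ultimately have "\<bar>marg f k y - f y\<bar> \<le> e / 2" by linarith
    then show ?thesis using e by (simp add: dist_real_def)
  qed
  then show "\<forall>\<^sub>F k in sequentially. \<forall>y\<in>cubeN. dist (marg f k y) (f y) < e"
    unfolding eventually_sequentially by blast
qed

end

section \<open>The Knothe--Rosenblatt map\<close>

lemma cond_dens_cong:
  assumes "\<And>j. j \<le> k \<Longrightarrow> y j = y' j"
  shows "cond_dens f (Suc k) y = cond_dens f (Suc k) y'"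
proof -
  have "marg f (Suc k) y = marg f (Suc k) y'" "marg f k y = marg f k y'"
    using assms by (auto intro: marg_cong)
  then show ?thesis
    using cond_dens_Suc[of f k y "y k"] cond_dens_Suc[of f k y' "y' k"] by simp
qed

lemma cond_cdf_cong:
  assumes "\<And>j. j \<le> k \<Longrightarrow> y j = y' j"
  shows "cond_cdf f k y = cond_cdf f k y'"
proof -
  have "cond_dens f (Suc k) (y(k := s)) = cond_dens f (Suc k) (y'(k := s))" for s
    by (rule cond_dens_cong) (use assms in auto)
  then show ?thesis using assms by (simp add: cond_cdf_def)
qed

text \<open>The transport is triangular.\<close>

lemma KR_transport_cong:
  assumes "\<And>j. j \<le> k \<Longrightarrow> y j = y' j"
  shows "KR_transport f\<rho> f\<pi> y k = KR_transport f\<rho> f\<pi> y' k"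
proof -
  have "trunc (Suc k) y = trunc (Suc k) y'" using assms by (auto simp: restrict_def)
  then show ?thesis by (simp add: KR_transport_def)
qed

text \<open>Conditional measures see only earlier coordinates, so the recursion holds without
  truncations, with the whole points \<open>y\<close> and \<open>T y\<close> as parameters.\<close>

lemma KR_transport_rec:
  "KR_transport f\<rho> f\<pi> y k =
    monotone_transport (cond_measure f\<rho> k y) (cond_measure f\<pi> k (KR_transport f\<rho> f\<pi> y)) (y k)"
proof -
  have tr: "trunc (Suc j) (trunc (Suc k) y) = trunc (Suc j) y" if "j < k" for j
    using that by (auto simp: restrict_def)
  have "(\<lambda>j\<in>{..<k}. KR_comp f\<rho> f\<pi> j (trunc (Suc j) (trunc (Suc k) y))) = trunc k (KR_transport f\<rho> f\<pi> y)"
    unfolding KR_transport_def by (rule restrict_ext) (simp only: tr lessThan_iff)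
  moreover have "cond_measure f\<pi> k (trunc k (KR_transport f\<rho> f\<pi> y)) = cond_measure f\<pi> k (KR_transport f\<rho> f\<pi> y)"
    "cond_measure f\<rho> k (trunc k (trunc (Suc k) y)) = cond_measure f\<rho> k y"
    by (auto intro!: cond_measure_cong)
  moreover have "KR_transport f\<rho> f\<pi> y k = monotone_transport (cond_measure f\<rho> k (trunc k (trunc (Suc k) y)))
      (cond_measure f\<pi> k (\<lambda>j\<in>{..<k}. KR_comp f\<rho> f\<pi> j (trunc (Suc j) (trunc (Suc k) y)))) (y k)"
    unfolding KR_transport_def by (subst KR_comp.simps) simp
  ultimately show ?thesis by (simp only:)
qed

context pos_density begin

text \<open>If the earlier coordinates agree, both points have the same conditional density at
  \<open>k\<close>, and its strictly increasing distribution function determines the coordinate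
  \<open>k\<close>.\<close>

lemma cond_cdf_inj:
  assumes "y \<in> cubeN" "z \<in> cubeN" "\<And>k. cond_cdf f k y = cond_cdf f k z"
  shows "y = z"
proof
  fix k show "y k = z k"
  proof (induction k rule: less_induct)
    case (less k)
    have "cond_dens f (Suc k) (y(k := s)) = cond_dens f (Suc k) (z(k := s))" for s
      by (rule cond_dens_cong) (use less in auto)
    then have "dens_cdf (\<lambda>s. cond_dens f (Suc k) (y(k := s))) (y k)
      = dens_cdf (\<lambda>s. cond_dens f (Suc k) (y(k := s))) (z k)"
      using assms(3)[of k] by (simp add: cond_cdf_def)
    then show ?case
      using assms(1,2) by (intro dens_cdf_inj[OF pos_dens_cond[OF assms(1)], of "y k" "z k" k]) (auto simp: cubeN_iff)
  qed
qed

lemma cond_dens_pos: "y \<in> cubeN \<Longrightarrow> 0 < cond_dens f (Suc k) y"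
  using pos_dens_cond[of y k] by (auto simp: pos_dens_def cubeN_iff dest!: bspec[of _ _ "y k"])

lemma nn_integral_mu: "(\<integral>\<^sup>+y. ennreal (f y) \<partial>mu) = 1"
  using integrable_f_comb_seq[of "\<lambda>_. 0" 0] pos
  by (subst nn_integral_eq_integral) (auto simp: comb_seq_0 int_1 space_mu cubeN_iff intro!: AE_I2 less_imp_le)

end

section \<open>Continuity, partial derivatives and bijectivity of the transport\<close>

locale KR_setting = r: pos_density f\<rho> + p: pos_density f\<pi> for f\<rho> f\<pi>
begin

abbreviation "T \<equiv> KR_transport f\<rho> f\<pi>"

lemma T_cubeN:
  assumes y: "y \<in> cubeN"
  shows "T y \<in> cubeN"
proof -
  have "T y k \<in> {-1..1}" for k
  proof (induction k rule: less_induct)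
    case (less k)
    \<comment> \<open>Only the first \<open>k\<close> coordinates of \<open>T y\<close> are known to lie in \<open>[-1,1]\<close> here, hence the padding.\<close>
    define u where "u = comb_seq k (T y) (\<lambda>_. 0)"
    have u: "u \<in> cubeN" using less by (auto simp: u_def comb_seq_def cubeN_iff)
    have "cond_measure f\<pi> k (T y) = cond_measure f\<pi> k u"
      by (rule cond_measure_cong) (simp add: u_def comb_seq_def)
    moreover have "y k \<in> {-1..1}" using y by (simp add: cubeN_iff)
    ultimately show ?case
      using monotone_transport_range[OF r.pos_dens_cond[OF y] p.pos_dens_cond[OF u], of "y k" k k]
      by (subst KR_transport_rec) (simp add: cond_measure_def)
  qed
  then show ?thesis by (simp add: cubeN_iff)
qed

lemma cond_cdf_T:
  assumes y: "y \<in> cubeN"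
  shows "cond_cdf f\<pi> k (T y) = cond_cdf f\<rho> k y"
proof -
  have "y k \<in> {-1..1}" using y by (simp add: cubeN_iff)
  from dens_cdf_monotone_transport[OF r.pos_dens_cond[OF y] p.pos_dens_cond[OF T_cubeN[OF y]] this, of k k]
  show ?thesis
    unfolding cond_cdf_def by (subst KR_transport_rec[of _ _ y k]) (simp add: cond_measure_def)
qed

text \<open>The conditional distribution functions of the target have slope at least \<open>c / 2\<close>, so an error in the
  value of such a function controls the error in its argument: \<open>\<bar>T y k - T y0 k\<bar>\<close> is at most \<open>D y\<close>, which
  is continuous in \<open>y\<close> by induction and vanishes at \<open>y0\<close>.\<close>

lemma continuous_on_T: "continuous_on cubeN T"
proof (rule continuous_on_coordinatewise_then_product)
  fix k show "continuous_on cubeN (\<lambda>y. T y k)"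
  proof (induction k rule: less_induct)
    case (less k)
    obtain c where c: "0 < c" "\<And>y k. y \<in> cubeN \<Longrightarrow> c \<le> cond_dens f\<pi> (Suc k) y"
      using p.cond_dens_lower_bound by metis
    show ?case unfolding continuous_on_def
    proof
      fix y0 assume y0: "y0 \<in> cubeN"
      define s0 where "s0 = T y0 k"
      have s0: "s0 \<in> {-1..1}" using T_cubeN[OF y0] by (simp add: s0_def cubeN_iff)
      \<comment> \<open>Coordinate \<open>k\<close> is frozen at \<open>s0\<close> and the later
        ones are set to 0, so continuity of \<open>V\<close> follows from the induction hypothesis
        alone.\<close>
      define V where "V y = (comb_seq k (T y) (\<lambda>_. 0))(k := s0)" for y
      have V: "V y \<in> cubeN" if "y \<in> cubeN" for y
        using T_cubeN[OF that] s0 by (auto simp: V_def cubeN_iff comb_seq_def)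
      have contV: "continuous_on cubeN V"
      proof (rule continuous_on_coordinatewise_then_product)
        fix i show "continuous_on cubeN (\<lambda>y. V y i)"
          using less[of i] by (cases i k rule: linorder_cases) (auto simp: V_def comb_seq_def)
      qed
      define D where "D y = 2 / c * \<bar>cond_cdf f\<rho> k y - cond_cdf f\<pi> k (V y)\<bar>" for y
      have D: "\<bar>T y k - s0\<bar> \<le> D y" if y: "y \<in> cubeN" for y
      proof -
        let ?q = "\<lambda>s. cond_dens f\<pi> (Suc k) ((T y)(k := s))"
        have "\<bar>T y k - s0\<bar> \<le> 2 / c * \<bar>dens_cdf ?q (T y k) - dens_cdf ?q s0\<bar>"
        proof (rule dens_cdf_abs_diff_ge[OF p.pos_dens_cond[OF T_cubeN[OF y]] c(1)])
          show "T y k \<in> {-1..1}" using T_cubeN[OF y] by (simp add: cubeN_iff)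
          show "c \<le> ?q t" if "t \<in> {-1..1}" for t
            by (rule c(2)[OF cubeN_upd[OF T_cubeN[OF y] that]])
        qed fact
        moreover have "dens_cdf ?q (T y k) = cond_cdf f\<rho> k y"
          using cond_cdf_T[OF y, of k] by (simp add: cond_cdf_def)
        moreover have "dens_cdf ?q s0 = cond_cdf f\<pi> k ((T y)(k := s0))"
          by (simp add: cond_cdf_def)
        moreover have "\<dots> = cond_cdf f\<pi> k (V y)"
          by (rule cond_cdf_cong) (auto simp: V_def comb_seq_def)
        ultimately show ?thesis unfolding D_def by metis
      qed
      have "cond_cdf f\<pi> k (V y0) = cond_cdf f\<pi> k (T y0)"
        by (rule cond_cdf_cong) (auto simp: V_def comb_seq_def s0_def)
      then have D0: "D y0 = 0" using cond_cdf_T[OF y0] by (simp add: D_def)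
      have "continuous_on cubeN (\<lambda>y. cond_cdf f\<pi> k (V y))"
        by (rule continuous_on_compose2[OF p.continuous_on_cond_cdf contV]) (use V in blast)
      then have "continuous_on cubeN D"
        unfolding D_def[abs_def]
        by (rule continuous_on_mult_left[OF continuous_on_rabs[OF continuous_on_diff[OF r.continuous_on_cond_cdf]]])
      then have "(D \<longlongrightarrow> 0) (at y0 within cubeN)"
        using y0 unfolding continuous_on_def D0[symmetric] by blast
      moreover have "\<forall>\<^sub>F y in at y0 within cubeN. norm (T y k - s0) \<le> D y"
        unfolding eventually_at_filter real_norm_def by (intro always_eventually allI impI D)
      ultimately have "((\<lambda>y. T y k - s0) \<longlongrightarrow> 0) (at y0 within cubeN)"
        by (rule Lim_null_comparison[rotated])
      then show "((\<lambda>y. T y k) \<longlongrightarrow> T y0 k) (at y0 within cubeN)"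
        unfolding s0_def by (rule LIM_zero_cancel)
    qed
  qed
qed

lemma measurable_T [measurable]: "T \<in> mu \<rightarrow>\<^sub>M mu"
  unfolding measurable_cong_sets[OF sets_mu sets_mu]
  by (rule measurable_restrict_space2)
    (auto simp: space_restrict_space intro!: T_cubeN borel_measurable_continuous_on_restrict continuous_on_T)

text \<open>Varying the coordinate \<open>k\<close> leaves both conditional measures unchanged, so
  the component \<open>k\<close> is a one-dimensional transport as a function of
  \<open>s\<close>.\<close>

lemma T_upd:
  "T (y(k := s)) k = monotone_transport (cond_measure f\<rho> k y) (cond_measure f\<pi> k (T y)) s"
proof -
  have "cond_measure f\<rho> k (y(k := s)) = cond_measure f\<rho> k y"
    "cond_measure f\<pi> k (T (y(k := s))) = cond_measure f\<pi> k (T y)"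
    by (auto intro!: cond_measure_cong KR_transport_cong)
  then show ?thesis by (subst KR_transport_rec) simp
qed

lemma has_partial_deriv:
  assumes y: "y \<in> cubeN"
  shows "((\<lambda>t. KR_comp f\<rho> f\<pi> k ((trunc (Suc k) y)(k := t))) has_real_derivative
    cond_dens f\<rho> (Suc k) y / cond_dens f\<pi> (Suc k) (T y)) (at (trunc (Suc k) y k) within {-1..1})"
proof -
  have "(trunc (Suc k) y)(k := t) = trunc (Suc k) (y(k := t))" for t
    by (auto simp: restrict_def)
  then have "KR_comp f\<rho> f\<pi> k ((trunc (Suc k) y)(k := t)) = T (y(k := t)) k" for t
    by (simp add: KR_transport_def)
  \<comment> \<open>The one-dimensional derivative formula evaluates the target density at the
    transported point, which is \<open>T y\<close> itself.\<close>
  moreover have "(T y)(k := monotone_transport (cond_measure f\<rho> k y) (cond_measure f\<pi> k (T y)) (y k)) = T y"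
    by (simp only: KR_transport_rec[symmetric] fun_upd_triv)
  moreover have "T y k = monotone_transport (cond_measure f\<rho> k y) (cond_measure f\<pi> k (T y)) (y k)"
    by (rule KR_transport_rec)
  moreover have "y k \<in> {-1..1}" using y by (simp add: cubeN_iff)
  ultimately show ?thesis
    using has_derivative_monotone_transport[OF r.pos_dens_cond[OF y] p.pos_dens_cond[OF T_cubeN[OF y]], of "y k" k k]
    by (simp add: T_upd cond_measure_def[symmetric])
qed

lemma partial_deriv_KR_comp:
  assumes y: "y \<in> cubeN"
  shows "partial_differentiable k (KR_comp f\<rho> f\<pi> k) (trunc (Suc k) y)"
    and "partial_deriv k (KR_comp f\<rho> f\<pi> k) (trunc (Suc k) y) =
      cond_dens f\<rho> (Suc k) y / cond_dens f\<pi> (Suc k) (T y)"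
proof -
  have *: "((\<lambda>t. KR_comp f\<rho> f\<pi> k ((trunc (Suc k) y)(k := t))) has_vector_derivative
    cond_dens f\<rho> (Suc k) y / cond_dens f\<pi> (Suc k) (T y)) (at (trunc (Suc k) y k) within {-1..1})"
    using has_partial_deriv[OF y] by (simp only: has_real_derivative_iff_has_vector_derivative)
  show "partial_differentiable k (KR_comp f\<rho> f\<pi> k) (trunc (Suc k) y)"
    unfolding partial_differentiable_def by (rule differentiableI_vector[OF *])
  have "trunc (Suc k) y k \<in> {-1..1}" using y by (simp add: cubeN_iff)
  then show "partial_deriv k (KR_comp f\<rho> f\<pi> k) (trunc (Suc k) y) =
      cond_dens f\<rho> (Suc k) y / cond_dens f\<pi> (Suc k) (T y)"
    unfolding partial_deriv_def
    by (intro vector_derivative_within_closed_interval[OF _ _ *]) auto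
qed

lemma KR_jac_prod_eq:
  assumes y: "y \<in> cubeN"
  shows "KR_jac_prod f\<rho> f\<pi> n y = marg f\<rho> n y / marg f\<pi> n (T y)"
proof (induction n)
  case (Suc n)
  have "cond_dens f (Suc n) z = marg f (Suc n) z / marg f n z" for f z
    using cond_dens_Suc[of f n z "z n"] by simp
  moreover have "KR_jac_prod f\<rho> f\<pi> (Suc n) y
    = KR_jac_prod f\<rho> f\<pi> n y * (cond_dens f\<rho> (Suc n) y / cond_dens f\<pi> (Suc n) (T y))"
    by (simp add: KR_jac_prod_def partial_deriv_KR_comp(2)[OF y])
  ultimately show ?case
    using r.marg_pos[OF y, of n] p.marg_pos[OF T_cubeN[OF y], of n] Suc by (simp add: field_simps)
qed (simp add: KR_jac_prod_def marg_def)

text \<open>Uniform convergence of the marginals of \<open>f\<pi>\<close> survives composition with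
  \<open>T\<close>, which maps \<open>cubeN\<close> into itself. The quotient then converges
  uniformly because \<open>f\<rho>\<close> is bounded and \<open>f\<pi>\<close> is bounded away from
  0.\<close>

lemma uniform_limit_KR_jac_prod:
  "uniform_limit cubeN (KR_jac_prod f\<rho> f\<pi>) (\<lambda>y. f\<rho> y / f\<pi> (T y)) sequentially"
proof -
  obtain c where c: "0 < c" "\<And>y. y \<in> cubeN \<Longrightarrow> c \<le> f\<pi> y" using p.bounds by metis
  have "uniform_limit cubeN (\<lambda>n y. marg f\<pi> n (T y)) (\<lambda>y. f\<pi> (T y)) sequentially"
    using uniform_limit_compose'[OF p.uniform_limit_marg, of T cubeN] T_cubeN by auto
  then have "uniform_limit cubeN (\<lambda>n y. marg f\<rho> n y / marg f\<pi> n (T y)) (\<lambda>y. f\<rho> y / f\<pi> (T y)) sequentially"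
  proof (rule uniform_lim_divide[OF r.uniform_limit_marg])
    show "bounded (f\<rho> ` cubeN)"
      by (intro compact_imp_bounded compact_continuous_image r.cont compact_cubeN)
    show "c \<le> norm (f\<pi> (T y))" if "y \<in> cubeN" for y
      using c(2)[OF T_cubeN[OF that]] by simp
  qed fact
  then show ?thesis by (rule uniform_limit_cong'[THEN iffD1, rotated -1]) (simp_all add: KR_jac_prod_eq)
qed

lemma KR_det_eq:
  assumes "y \<in> cubeN"
  shows "KR_det f\<rho> f\<pi> y = f\<rho> y / f\<pi> (T y)"
  unfolding KR_det_def
  by (rule limI) (rule tendsto_uniform_limitI[OF uniform_limit_KR_jac_prod assms])

lemma continuous_on_f_T: "continuous_on cubeN (\<lambda>y. f\<pi> (T y))"
  by (rule continuous_on_compose2[OF p.cont continuous_on_T]) (auto intro: T_cubeN)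

lemma KR_det_C0_pos: "KR_det f\<rho> f\<pi> \<in> C0_pos cubeN"
proof -
  have "continuous_on cubeN (\<lambda>y. f\<rho> y / f\<pi> (T y))"
    using p.pos[OF T_cubeN] less_irrefl[of "0 :: real"]
    by (intro continuous_on_divide r.cont continuous_on_f_T) metis
  then have "continuous_on cubeN (KR_det f\<rho> f\<pi>)"
    by (subst continuous_on_cong[OF refl KR_det_eq])
  then show ?thesis by (auto simp: C0_pos_def KR_det_eq r.pos p.pos T_cubeN)
qed

lemma partial_deriv_C0_pos:
  shows "y \<in> cube (Suc k) \<Longrightarrow> partial_differentiable k (KR_comp f\<rho> f\<pi> k) y"
    and "partial_deriv k (KR_comp f\<rho> f\<pi> k) \<in> C0_pos (cube (Suc k))"
proof -
  \<comment> \<open>Padding with zeros embeds \<open>cube (Suc k)\<close> continuously into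
    \<open>cubeN\<close>, where the formula for the derivative is available.\<close>
  define e :: "(nat \<Rightarrow> real) \<Rightarrow> nat \<Rightarrow> real" where "e y = comb_seq (Suc k) y (\<lambda>_. 0)" for y
  have e: "e y \<in> cubeN" "trunc (Suc k) (e y) = y" if "y \<in> cube (Suc k)" for y
    using that by (auto simp: e_def cube_def cubeN_iff comb_seq_def restrict_def PiE_iff fun_eq_iff extensional_def)
  show "partial_differentiable k (KR_comp f\<rho> f\<pi> k) y" if "y \<in> cube (Suc k)"
    using partial_deriv_KR_comp(1)[OF e(1)[OF that], of k] by (simp add: e(2)[OF that])
  let ?g = "\<lambda>y. cond_dens f\<rho> (Suc k) y / cond_dens f\<pi> (Suc k) (T y)"
  have pos: "0 < cond_dens f\<rho> (Suc k) y" "0 < cond_dens f\<pi> (Suc k) (T y)" if "y \<in> cubeN" for y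
    using r.cond_dens_pos[OF that] p.cond_dens_pos[OF T_cubeN[OF that]] by auto
  have eq: "partial_deriv k (KR_comp f\<rho> f\<pi> k) y = ?g (e y)" if "y \<in> cube (Suc k)" for y
    using partial_deriv_KR_comp(2)[OF e(1)[OF that], of k] by (simp add: e(2)[OF that])
  have "continuous_on cubeN ?g"
    by (intro continuous_on_divide r.continuous_on_cond_dens
        continuous_on_compose2[OF p.continuous_on_cond_dens continuous_on_T])
      (auto dest: pos(2) intro: T_cubeN)
  then have "continuous_on (cube (Suc k)) (\<lambda>y. ?g (e y))"
    by (rule continuous_on_compose2) (auto simp: e_def[abs_def] intro: e[unfolded e_def] continuous_on_comb_seq)
  then have "continuous_on (cube (Suc k)) (partial_deriv k (KR_comp f\<rho> f\<pi> k))"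
    by (subst continuous_on_cong[OF refl eq])
  then show "partial_deriv k (KR_comp f\<rho> f\<pi> k) \<in> C0_pos (cube (Suc k))"
    using pos e(1) by (auto simp: C0_pos_def eq)
qed

lemma bij_betw_T: "bij_betw T cubeN cubeN"
proof -
  \<comment> \<open>The inverse is the transport with the two densities exchanged.\<close>
  interpret s: KR_setting f\<pi> f\<rho> ..
  show ?thesis
  proof (rule bij_betwI[where g="s.T"])
    fix y assume y: "y \<in> cubeN"
    show "s.T (T y) = y"
      by (rule r.cond_cdf_inj) (simp_all add: y T_cubeN s.T_cubeN cond_cdf_T s.cond_cdf_T)
    show "T (s.T y) = y"
      by (rule p.cond_cdf_inj) (simp_all add: y T_cubeN s.T_cubeN cond_cdf_T s.cond_cdf_T)
  qed (auto intro: T_cubeN s.T_cubeN)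
qed

end

section \<open>The image measure\<close>

lemma measurable_upd_mu: "(\<lambda>(y, s). y(k := s)) \<in> mu \<Otimes>\<^sub>M mu1 \<rightarrow>\<^sub>M mu"
  using measurable_add_dim[of k UNIV "\<lambda>_. mu1"] by (simp add: mu_def)

lemma measurable_upd_mu1:
  assumes "y \<in> cubeN"
  shows "(\<lambda>s. y(k := s)) \<in> mu1 \<rightarrow>\<^sub>M mu"
  using measurable_compose[OF measurable_Pair[OF measurable_const measurable_ident] measurable_upd_mu] assms
  by (simp add: space_mu)

text \<open>Redrawing the coordinate \<open>k\<close> independently from \<open>mu1\<close>
  preserves \<open>mu\<close>.\<close>

lemma nn_integral_mu_resample:
  assumes [measurable]: "g \<in> borel_measurable mu"
  shows "(\<integral>\<^sup>+y. g y \<partial>mu) = (\<integral>\<^sup>+y. (\<integral>\<^sup>+s. g (y(k := s)) \<partial>mu1) \<partial>mu)"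
proof -
  interpret m1: prob_space mu1 by (rule prob_space_mu1)
  interpret m: prob_space mu by (rule prob_space_mu)
  interpret P2: pair_prob_space mu1 mu ..
  have m: "(\<lambda>(s, y). y(k := s)) \<in> mu1 \<Otimes>\<^sub>M mu \<rightarrow>\<^sub>M mu"
    using measurable_compose[OF measurable_pair_swap' measurable_upd_mu, of k] by (simp add: case_prod_unfold)
  \<comment> \<open>The index set already contains \<open>k\<close>: the rule is used to overwrite a
    coordinate, not to add one.\<close>
  have d: "distr (mu1 \<Otimes>\<^sub>M mu) mu (\<lambda>(s, y). y(k := s)) = mu"
    using distr_pair_PiM_eq_PiM[of UNIV "\<lambda>_. mu1" k] prob_space_mu1 by (simp add: mu_def)
  have "(\<integral>\<^sup>+y. g y \<partial>mu) = (\<integral>\<^sup>+y. g y \<partial>distr (mu1 \<Otimes>\<^sub>M mu) mu (\<lambda>(s, y). y(k := s)))"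
    by (simp only: d)
  also have "\<dots> = (\<integral>\<^sup>+x. (case x of (s, y) \<Rightarrow> g (y(k := s))) \<partial>(mu1 \<Otimes>\<^sub>M mu))"
    using assms by (subst nn_integral_distr[OF m]) (simp_all add: case_prod_unfold)
  also have "\<dots> = (\<integral>\<^sup>+y. (\<integral>\<^sup>+s. g (y(k := s)) \<partial>mu1) \<partial>mu)"
    by (subst P2.nn_integral_snd[symmetric])
      (use measurable_compose[OF m assms] in \<open>simp_all add: case_prod_unfold\<close>)
  finally show ?thesis .
qed

definition depends_below :: "nat \<Rightarrow> ((nat \<Rightarrow> 'a) \<Rightarrow> 'b) \<Rightarrow> bool" where
  "depends_below n g \<longleftrightarrow> (\<forall>y z. (\<forall>j<n. y j = z j) \<longrightarrow> g y = g z)"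

lemma depends_belowD: "depends_below n g \<Longrightarrow> (\<And>j. j < n \<Longrightarrow> y j = z j) \<Longrightarrow> g y = g z"
  by (auto simp: depends_below_def)

context pos_density begin

text \<open>Replacing the tail after coordinate \<open>n\<close> by an independent one preserves
  \<open>mu\<close> and does not affect \<open>g\<close>; integrating over that tail turns
  \<open>f\<close> into its marginal.\<close>

lemma nn_integral_marg:
  assumes [measurable]: "g \<in> borel_measurable mu" and dep: "depends_below n g"
  shows "(\<integral>\<^sup>+y. g y * ennreal (f y) \<partial>mu) = (\<integral>\<^sup>+y. g y * ennreal (marg f n y) \<partial>mu)"
proof -
  interpret sequence_space mu1 by (rule sequence_space_mu1)
  interpret m: prob_space mu by (rule prob_space_mu)
  interpret P2: pair_prob_space mu mu ..
  let ?c = "\<lambda>(y, t). comb_seq n y t"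
  have m: "?c \<in> mu \<Otimes>\<^sub>M mu \<rightarrow>\<^sub>M mu"
    unfolding mu_def by (rule measurable_comb_seq)
  have d: "distr (mu \<Otimes>\<^sub>M mu) mu ?c = mu"
    unfolding mu_def by (rule PiM_comb_seq)
  have gf: "(\<lambda>y. g y * ennreal (f y)) \<in> borel_measurable mu" by measurable
  have "(\<integral>\<^sup>+y. g y * ennreal (f y) \<partial>mu) = (\<integral>\<^sup>+y. g y * ennreal (f y) \<partial>distr (mu \<Otimes>\<^sub>M mu) mu ?c)"
    by (simp only: d)
  also have "\<dots> = (\<integral>\<^sup>+x. g (?c x) * ennreal (f (?c x)) \<partial>(mu \<Otimes>\<^sub>M mu))"
    by (rule nn_integral_distr[OF m]) (use gf in simp)
  also have "\<dots> = (\<integral>\<^sup>+y. (\<integral>\<^sup>+t. g (comb_seq n y t) * ennreal (f (comb_seq n y t)) \<partial>mu) \<partial>mu)"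
    by (subst m.nn_integral_fst[symmetric, OF measurable_compose[OF m gf]]) simp
  also have "\<dots> = (\<integral>\<^sup>+y. g y * ennreal (marg f n y) \<partial>mu)"
  proof (rule nn_integral_cong)
    fix y assume "y \<in> space mu"
    then have y: "y \<in> cubeN" by (simp add: space_mu)
    have "g (comb_seq n y t) = g y" for t
      by (rule depends_belowD[OF dep]) (simp add: comb_seq_def)
    moreover have "(\<integral>\<^sup>+t. ennreal (f (comb_seq n y t)) \<partial>mu) = ennreal (marg f n y)"
      unfolding marg_eq
      by (rule nn_integral_eq_integral[OF integrable_f_comb_seq[OF y]])
        (intro AE_I2 less_imp_le pos cubeN_comb_seq y, simp add: space_mu)
    ultimately show "(\<integral>\<^sup>+t. g (comb_seq n y t) * ennreal (f (comb_seq n y t)) \<partial>mu) = g y * ennreal (marg f n y)"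
      using integrable_f_comb_seq[OF y, of n] by (simp add: nn_integral_cmult)
  qed
  finally show ?thesis .
qed

lemma measurable_cond_dens [measurable]: "cond_dens f (Suc n) \<in> borel_measurable mu"
  by (rule borel_measurable_mu_continuous_on[OF continuous_on_cond_dens])

lemma measurable_cond_integral:
  assumes [measurable]: "g \<in> borel_measurable mu"
  shows "(\<lambda>y. \<integral>\<^sup>+s. g (y(n := s)) * ennreal (cond_dens f (Suc n) (y(n := s))) \<partial>mu1) \<in> borel_measurable mu"
proof -
  interpret m1: prob_space mu1 by (rule prob_space_mu1)
  have "(\<lambda>y. g y * ennreal (cond_dens f (Suc n) y)) \<in> borel_measurable mu" by measurable
  from measurable_compose[OF measurable_upd_mu this]
  have "(\<lambda>(y, s). g (y(n := s)) * ennreal (cond_dens f (Suc n) (y(n := s)))) \<in> borel_measurable (mu \<Otimes>\<^sub>M mu1)"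
    by (simp add: case_prod_unfold)
  then show ?thesis by (rule m1.borel_measurable_nn_integral)
qed

lemma depends_below_cond_integral:
  assumes dep: "depends_below (Suc n) g"
  shows "depends_below n (\<lambda>y. \<integral>\<^sup>+s. g (y(n := s)) * ennreal (cond_dens f (Suc n) (y(n := s))) \<partial>mu1)"
  unfolding depends_below_def
proof (intro allI impI)
  fix y z :: "nat \<Rightarrow> real" assume eq: "\<forall>j<n. y j = z j"
  have "g (y(n := s)) = g (z(n := s))" for s
    by (rule depends_belowD[OF dep]) (use eq in auto)
  moreover have "cond_dens f (Suc n) (y(n := s)) = cond_dens f (Suc n) (z(n := s))" for s
    by (rule cond_dens_cong) (use eq in auto)
  ultimately show "(\<integral>\<^sup>+s. g (y(n := s)) * ennreal (cond_dens f (Suc n) (y(n := s))) \<partial>mu1)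
    = (\<integral>\<^sup>+s. g (z(n := s)) * ennreal (cond_dens f (Suc n) (z(n := s))) \<partial>mu1)" by simp
qed

text \<open>Pass to the marginal with index \<open>Suc n\<close>, redraw the coordinate
  \<open>n\<close>, and factor that marginal as conditional density times \<open>marg f n\<close>.
  The inner integral depends only on the first \<open>n\<close> coordinates, so
  \<open>marg f n\<close> may be replaced by \<open>f\<close> again.\<close>

lemma nn_integral_disintegrate:
  assumes g [measurable]: "g \<in> borel_measurable mu" and dep: "depends_below (Suc n) g"
  shows "(\<integral>\<^sup>+y. g y * ennreal (f y) \<partial>mu) =
    (\<integral>\<^sup>+y. (\<integral>\<^sup>+s. g (y(n := s)) * ennreal (cond_dens f (Suc n) (y(n := s))) \<partial>mu1) * ennreal (f y) \<partial>mu)"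
    (is "_ = (\<integral>\<^sup>+y. ?g y * _ \<partial>mu)")
proof -
  have [measurable]: "marg f n \<in> borel_measurable mu" for n
    by (rule borel_measurable_mu_continuous_on[OF continuous_on_marg])
  have "(\<integral>\<^sup>+y. g y * ennreal (f y) \<partial>mu) = (\<integral>\<^sup>+y. g y * ennreal (marg f (Suc n) y) \<partial>mu)"
    by (rule nn_integral_marg[OF g dep])
  also have "\<dots> = (\<integral>\<^sup>+y. (\<integral>\<^sup>+s. g (y(n := s)) * ennreal (marg f (Suc n) (y(n := s))) \<partial>mu1) \<partial>mu)"
    by (rule nn_integral_mu_resample) measurable
  also have "\<dots> = (\<integral>\<^sup>+y. ?g y * ennreal (marg f n y) \<partial>mu)"
  proof (rule nn_integral_cong)
    fix y assume "y \<in> space mu"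
    then have y: "y \<in> cubeN" by (simp add: space_mu)
    have eq: "ennreal (marg f (Suc n) (y(n := s))) = ennreal (cond_dens f (Suc n) (y(n := s))) * ennreal (marg f n y)"
      if "s \<in> space mu1" for s
    proof -
      have "0 \<le> cond_dens f (Suc n) (y(n := s))"
        using cond_dens_pos[OF cubeN_upd[OF y], of s n n] that by (simp add: space_mu1)
      then show ?thesis
        using marg_pos[OF y, of n] by (simp add: ennreal_mult[symmetric] cond_dens_Suc)
    qed
    have "(\<lambda>y. g y * ennreal (cond_dens f (Suc n) y)) \<in> borel_measurable mu" by measurable
    from measurable_compose[OF measurable_upd_mu1[OF y] this]
    show "(\<integral>\<^sup>+s. g (y(n := s)) * ennreal (marg f (Suc n) (y(n := s))) \<partial>mu1) = ?g y * ennreal (marg f n y)"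
      by (subst nn_integral_multc[symmetric]) (auto intro!: nn_integral_cong simp: eq mult.assoc)
  qed
  also have "\<dots> = (\<integral>\<^sup>+y. ?g y * ennreal (f y) \<partial>mu)"
    by (rule nn_integral_marg[symmetric])
      (intro measurable_cond_integral g depends_below_cond_integral dep)+
  finally show ?thesis .
qed

lemma prob_space_density_mu: "prob_space (density_mu f)"
  by (rule prob_spaceI) (simp add: density_mu_def emeasure_density nn_integral_mu space_mu[symmetric]
    cong: nn_integral_cong_simp)

end

section \<open>Change of variables for functions of finitely many coordinates\<close>

context KR_setting begin

lemma cond_integral_T:
  assumes y: "y \<in> cubeN" and g[measurable]: "g \<in> borel_measurable mu" and dep: "depends_below (Suc n) g"
  shows "(\<integral>\<^sup>+s. g (T (y(n := s))) * ennreal (cond_dens f\<rho> (Suc n) (y(n := s))) \<partial>mu1) =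
    (\<integral>\<^sup>+s. g ((T y)(n := s)) * ennreal (cond_dens f\<pi> (Suc n) ((T y)(n := s))) \<partial>mu1)"
proof -
  let ?p = "\<lambda>s. cond_dens f\<rho> (Suc n) (y(n := s))" and ?q = "\<lambda>s. cond_dens f\<pi> (Suc n) ((T y)(n := s))"
  let ?M = "density mu1 (\<lambda>s. ennreal (?p s))" and ?N = "density mu1 (\<lambda>s. ennreal (?q s))"
  let ?S = "monotone_transport ?M ?N" and ?G = "\<lambda>s. g ((T y)(n := s))"
  note S = monotone_transport[OF r.pos_dens_cond[OF y] p.pos_dens_cond[OF T_cubeN[OF y]], of n n]
  have [measurable]: "?p \<in> borel_measurable mu1" "?q \<in> borel_measurable mu1" "?G \<in> borel_measurable mu1"
    by (rule measurable_compose[OF measurable_upd_mu1]; simp add: y T_cubeN)+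
  \<comment> \<open>Beyond coordinate \<open>n\<close> the two points may differ, but
    \<open>g\<close> does not see those coordinates.\<close>
  have "g (T (y(n := s))) = ?G (?S s)" for s
  proof (rule depends_belowD[OF dep])
    fix j assume "j < Suc n"
    moreover have "T (y(n := s)) j = T y j" if "j < n"
      by (rule KR_transport_cong) (use that in auto)
    ultimately show "T (y(n := s)) j = ((T y)(n := ?S s)) j"
      by (cases "j = n") (auto simp: T_upd cond_measure_def)
  qed
  then have "(\<integral>\<^sup>+s. g (T (y(n := s))) * ennreal (?p s) \<partial>mu1) = (\<integral>\<^sup>+s. ennreal (?p s) * ?G (?S s) \<partial>mu1)"
    by (simp add: mult.commute)
  also have "\<dots> = (\<integral>\<^sup>+s. ?G (?S s) \<partial>?M)"
    using S(3) by (subst nn_integral_density) (auto intro: measurable_compose)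
  also have "\<dots> = (\<integral>\<^sup>+s. ?G s \<partial>distr ?M ?N ?S)"
    by (subst nn_integral_distr[OF S(3)]) auto
  also have "\<dots> = (\<integral>\<^sup>+s. ?G s \<partial>?N)" by (simp only: S(4))
  also have "\<dots> = (\<integral>\<^sup>+s. ?G s * ennreal (?q s) \<partial>mu1)"
    by (subst nn_integral_density) (auto simp: mult.commute)
  finally show ?thesis .
qed

lemma nn_integral_T:
  assumes "g \<in> borel_measurable mu" "depends_below n g"
  shows "(\<integral>\<^sup>+y. g (T y) * ennreal (f\<rho> y) \<partial>mu) = (\<integral>\<^sup>+y. g y * ennreal (f\<pi> y) \<partial>mu)"
  using assms
proof (induction n arbitrary: g)
  case 0
  have "g y = g (\<lambda>_. 0)" for y by (rule depends_belowD[OF 0(2)]) auto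
  then have g: "g = (\<lambda>_. g (\<lambda>_. 0))" by (rule ext)
  show ?case
    by (subst (1 2) g) (simp add: nn_integral_cmult r.nn_integral_mu p.nn_integral_mu)
next
  case (Suc n)
  note g [measurable] = Suc.prems(1)
  let ?g = "\<lambda>y. \<integral>\<^sup>+s. g (y(n := s)) * ennreal (cond_dens f\<pi> (Suc n) (y(n := s))) \<partial>mu1"
  have "depends_below (Suc n) (\<lambda>y. g (T y))"
    unfolding depends_below_def
    by (intro allI impI depends_belowD[OF Suc.prems(2)] KR_transport_cong) auto
  then have "(\<integral>\<^sup>+y. g (T y) * ennreal (f\<rho> y) \<partial>mu) =
    (\<integral>\<^sup>+y. (\<integral>\<^sup>+s. g (T (y(n := s))) * ennreal (cond_dens f\<rho> (Suc n) (y(n := s))) \<partial>mu1) * ennreal (f\<rho> y) \<partial>mu)"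
    by (intro r.nn_integral_disintegrate) measurable
  also have "\<dots> = (\<integral>\<^sup>+y. ?g (T y) * ennreal (f\<rho> y) \<partial>mu)"
    by (intro nn_integral_cong arg_cong2[of _ _ _ _ "(*)"] cond_integral_T g Suc.prems(2) refl)
      (simp add: space_mu)
  \<comment> \<open>The induction hypothesis is applied to the conditional integral
    \<open>?g\<close> in place of \<open>g\<close>; it depends on one coordinate fewer.\<close>
  also have "\<dots> = (\<integral>\<^sup>+y. ?g y * ennreal (f\<pi> y) \<partial>mu)"
    by (intro Suc.IH p.measurable_cond_integral p.depends_below_cond_integral g Suc.prems(2))
  also have "\<dots> = (\<integral>\<^sup>+y. g y * ennreal (f\<pi> y) \<partial>mu)"
    by (rule p.nn_integral_disintegrate[OF g Suc.prems(2), symmetric])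
  finally show ?case .
qed

lemma measurable_T_density: "T \<in> density_mu f\<rho> \<rightarrow>\<^sub>M density_mu f\<pi>"
  using measurable_T by (simp add: density_mu_def)

text \<open>Finite measures on the product that agree on cylinder sets are equal, and a cylinder
  over a finite index set constrains only finitely many coordinates.\<close>

lemma distr_T: "distr (density_mu f\<rho>) (density_mu f\<pi>) T = density_mu f\<pi>"
proof (rule measure_eqI_PiM_infinite)
  show s: "sets (density_mu f\<pi>) = sets (PiM UNIV (\<lambda>_. mu1))"
    by (simp add: density_mu_def mu_def)
  show "sets (distr (density_mu f\<rho>) (density_mu f\<pi>) T) = sets (PiM UNIV (\<lambda>_. mu1))"
    by (simp add: s)
  interpret prob_space "distr (density_mu f\<rho>) (density_mu f\<pi>) T"
    by (rule prob_space.prob_space_distr[OF r.prob_space_density_mu measurable_T_density])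
  show "finite_measure (distr (density_mu f\<rho>) (density_mu f\<pi>) T)"
    by (rule finite_measure_axioms)
  fix J :: "nat set" and F assume J: "finite J" and F: "\<And>j. j \<in> J \<Longrightarrow> F j \<in> sets mu1"
  let ?A = "prod_emb UNIV (\<lambda>_. mu1) J (Pi\<^sub>E J F)"
  have A: "?A \<in> sets mu" unfolding mu_def by (rule sets_PiM_I) (use J F in auto)
  have Ad: "?A \<in> sets (density_mu f\<pi>)" using A by (simp add: density_mu_def)
  obtain n where n: "J \<subseteq> {..<n}" using finite_nat_iff_bounded J by blast
  \<comment> \<open>Membership in \<open>?A\<close> also forces every coordinate into
    \<open>[-1,1]\<close>, so its indicator depends on all of them. \<open>B\<close> omits this
    constraint and agrees with \<open>?A\<close> on \<open>cubeN\<close>.\<close>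
  define B where "B = {y :: nat \<Rightarrow> real. \<forall>j\<in>J. y j \<in> F j}"
  have AB: "y \<in> ?A \<longleftrightarrow> y \<in> B" if "y \<in> cubeN" for y
    using that by (auto simp: B_def prod_emb_def space_mu1 cubeN_def)
  have g: "(indicator B :: _ \<Rightarrow> ennreal) \<in> borel_measurable mu"
  proof -
    have "(indicator ?A :: _ \<Rightarrow> ennreal) \<in> borel_measurable mu" using A by simp
    then show ?thesis
      by (rule measurable_cong[THEN iffD1, rotated]) (simp add: space_mu AB indicator_def)
  qed
  have dep: "depends_below n (indicator B :: _ \<Rightarrow> ennreal)"
    using n unfolding depends_below_def B_def indicator_def by (auto simp: subset_iff)
  have "emeasure (distr (density_mu f\<rho>) (density_mu f\<pi>) T) ?A
    = (\<integral>\<^sup>+y. indicator ?A y \<partial>distr (density_mu f\<rho>) (density_mu f\<pi>) T)"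
    using Ad by simp
  also have "\<dots> = (\<integral>\<^sup>+y. indicator ?A (T y) \<partial>density_mu f\<rho>)"
    by (rule nn_integral_distr[OF measurable_T_density]) (use Ad in simp)
  also have "\<dots> = (\<integral>\<^sup>+y. ennreal (f\<rho> y) * indicator ?A (T y) \<partial>mu)"
    unfolding density_mu_def
    by (rule nn_integral_density) (use A in measurable)
  also have "\<dots> = (\<integral>\<^sup>+y. indicator B (T y) * ennreal (f\<rho> y) \<partial>mu)"
    by (rule nn_integral_cong) (simp add: space_mu AB T_cubeN indicator_def)
  also have "\<dots> = (\<integral>\<^sup>+y. indicator B y * ennreal (f\<pi> y) \<partial>mu)"
    by (rule nn_integral_T[OF g dep])
  also have "\<dots> = (\<integral>\<^sup>+y. ennreal (f\<pi> y) * indicator ?A y \<partial>mu)"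
    by (rule nn_integral_cong) (simp add: space_mu AB indicator_def)
  also have "\<dots> = emeasure (density_mu f\<pi>) ?A"
    unfolding density_mu_def using A by (subst emeasure_density) auto
  finally show "emeasure (distr (density_mu f\<rho>) (density_mu f\<pi>) T) ?A = emeasure (density_mu f\<pi>) ?A" .
qed

end

theorem theorem3p3:
  fixes f\<rho> f\<pi> :: "(nat \<Rightarrow> real) \<Rightarrow> real"
  assumes "f\<rho> \<in> C0_pos cubeN" and "prob_density_mu f\<rho>"
    and "f\<pi> \<in> C0_pos cubeN" and "prob_density_mu f\<pi>"
  shows "KR_transport f\<rho> f\<pi> \<in> density_mu f\<rho> \<rightarrow>\<^sub>M density_mu f\<pi> \<and>
     bij_betw (KR_transport f\<rho> f\<pi>) cubeN cubeN \<and>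
     distr (density_mu f\<rho>) (density_mu f\<pi>) (KR_transport f\<rho> f\<pi>) = density_mu f\<pi> \<and>
     (\<forall>k. (\<forall>y\<in>cube (Suc k). partial_differentiable k (KR_comp f\<rho> f\<pi> k) y) \<and>
          partial_deriv k (KR_comp f\<rho> f\<pi> k) \<in> C0_pos (cube (Suc k))) \<and>
     uniform_limit cubeN (KR_jac_prod f\<rho> f\<pi>) (KR_det f\<rho> f\<pi>) sequentially \<and>
     KR_det f\<rho> f\<pi> \<in> C0_pos cubeN \<and>
     (\<forall>y\<in>cubeN. f\<pi> (KR_transport f\<rho> f\<pi> y) * KR_det f\<rho> f\<pi> y = f\<rho> y)"
proof -
  interpret KR_setting f\<rho> f\<pi>
    using assms by unfold_locales (auto simp: C0_pos_def prob_density_mu_def)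
  have "uniform_limit cubeN (KR_jac_prod f\<rho> f\<pi>) (KR_det f\<rho> f\<pi>) sequentially"
    using uniform_limit_KR_jac_prod
    by (rule uniform_limit_cong'[THEN iffD1, rotated -1]) (simp_all add: KR_det_eq)
  moreover have "f\<pi> (T y) * KR_det f\<rho> f\<pi> y = f\<rho> y" if "y \<in> cubeN" for y
    using p.pos[OF T_cubeN[OF that]] by (simp add: KR_det_eq that)
  ultimately show ?thesis
    using measurable_T_density bij_betw_T distr_T partial_deriv_C0_pos KR_det_C0_pos by blast
qed

end
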